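(* Fix an integer $N\ge1$ and a gain $K_1\in\mathcal L(\mathbb R^p,\mathbb R^m)$. Suppose that: 1. the residual dissipation margin $\mu_s:=d_-\lambda_{N+1}-\ell_s(K_1)$ satisfies $\mu_s>0$; 2. there exist a self-adjoint positive-definite operator $\Pi:X_c\to X_c$ and a constant $\mu_c>0$ such that $$\Pi G_{cc}(d)+G_{cc}(d)^*\Pi\le-2\mu_c\Pi,\qquad\forall d\in[d_-,d_+];$$ 3. there exists $\eta>0$ such that $$4\eta\mu_c\mu_s>\left(\gamma_{cs}+\eta\gamma_{sc}\right)^2 .$$ Then there exist constants $M\ge1$ and $\omega>0$, independent of the admissible trajectory $d(\cdot)$, such that for every measurable $d(\cdot):[0,\infty)\to[d_-,d_+]$ every solution of $$\dot z(t)+d(t)A_0z(t)+(A_r-BK_1C)z(t)=0$$ satisfies $$\|z(t)\|_X\le Me^{-\omega(t-s)}\|z(s)\|_X,\qquad 0\le s\le t.$$ Hence, the regular evolution family is uniformly exponentially stable.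
   Context: $X$ is a Hilbert space; $A_r\in\mathcal L(X)$, $B\in\mathcal L(\mathbb R^m,X)$, $C\in\mathcal L(X,\mathbb R^p)$. Assumption on the coefficients: $\alpha,\beta\in C^1((0,T])$ are positive on $(0,T]$, $\alpha(0)=0$, and $0<d_-\le\beta(t)/\alpha(t)\le d_+<\infty$ on $(0,T]$ for constants $d_-,d_+$; in the stability analysis, the ratio is replaced by an arbitrary measurable parameter trajectory $d(\cdot):[0,\infty)\to[d_-,d_+]$ (an admissible trajectory). Assumption on $A_0$: $A_0:D(A_0)\subset X\to X$ is densely defined, self-adjoint, strictly positive, with compact resolvent, so there is an orthonormal basis $\{\phi_j\}_{j\ge1}$ of $X$ with $A_0\phi_j=\lambda_j\phi_j$, $0<\lambda_1\le\lambda_2\le\cdots$, $\lambda_j\to+\infty$. Notation: $L_K:=A_r-BK_1C$. $X_c:=\operatorname{span}\{\phi_1,\dots,\phi_N\}$, $X_s:=X_c^\perp$, with orthogonal projections $P_N:X\to X_c$ and $Q_N:=I-P_N:X\to X_s$. $A_{0,c}:=A_0|_{X_c}$. $G_{cc}(d):=-dA_{0,c}-P_NL_KP_N$ (on $X_c$), $G_{cs}:=-P_NL_KQ_N$ (from $X_s$ to $X_c$), $G_{sc}:=-Q_NL_KP_N$ (from $X_c$ to $X_s$). $\ell_s(K_1):=\sup_{x_s\in X_s,\ \|x_s\|_X=1}\operatorname{Re}\langle-Q_NL_KQ_Nx_s,x_s\rangle_X$. $\gamma_{cs}:=\|\Pi^{1/2}G_{cs}\|_{\mathcal L(X_s,X_c)}$,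 $\gamma_{sc}:=\|G_{sc}\Pi^{-1/2}\|_{\mathcal L(X_c,X_s)}$. Solutions are strong solutions and, more generally, mild solutions given by the associated evolution family. *)

theory Defs
  imports "HOL-Analysis.Analysis"
begin

(* The Hilbert space X is a type of sort {real_inner, banach}. Where Bochner integrals of
   X-valued functions occur, second_countable_topology (separability) is required as well; it is
   automatic here, since X has a countable orthonormal basis. *)

(* A function 'a => 'a is used as an operator on a subspace V through its values on V only. *)

definition linear_on :: "'a::real_vector set \<Rightarrow> ('a \<Rightarrow> 'b::real_vector) \<Rightarrow> bool" where
  "linear_on V T \<longleftrightarrow>
     (\<forall>x\<in>V. \<forall>y\<in>V. T (x + y) = T x + T y) \<and> (\<forall>c. \<forall>x\<in>V. T (c *\<^sub>R x) = c *\<^sub>R T x)"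

definition selfadjoint_posdef_on :: "'a::real_inner set \<Rightarrow> ('a \<Rightarrow> 'a) \<Rightarrow> bool" where
  "selfadjoint_posdef_on V T \<longleftrightarrow>
     T ` V \<subseteq> V \<and> linear_on V T \<and>
     (\<forall>x\<in>V. \<forall>y\<in>V. T x \<bullet> y = x \<bullet> T y) \<and>
     (\<forall>x\<in>V. x \<noteq> 0 \<longrightarrow> 0 < T x \<bullet> x)"

(* The adjoint and the positive square root are unique on V, so SOME only leaves the irrelevant
   values outside V open. *)

definition adjoint_on :: "'a::real_inner set \<Rightarrow> ('a \<Rightarrow> 'a) \<Rightarrow> 'a \<Rightarrow> 'a" where
  "adjoint_on V T = (SOME T'. T' ` V \<subseteq> V \<and> (\<forall>x\<in>V. \<forall>y\<in>V. T x \<bullet> y = x \<bullet> T' y))"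

definition sqrt_on :: "'a::real_inner set \<Rightarrow> ('a \<Rightarrow> 'a) \<Rightarrow> 'a \<Rightarrow> 'a" where
  "sqrt_on V T = (SOME R. selfadjoint_posdef_on V R \<and> (\<forall>x\<in>V. R (R x) = T x))"

definition inv_sqrt_on :: "'a::real_inner set \<Rightarrow> ('a \<Rightarrow> 'a) \<Rightarrow> 'a \<Rightarrow> 'a" where
  "inv_sqrt_on V T = inv_into V (sqrt_on V T)"

definition op_le_on :: "'a::real_inner set \<Rightarrow> ('a \<Rightarrow> 'a) \<Rightarrow> ('a \<Rightarrow> 'a) \<Rightarrow> bool" where
  "op_le_on V S T \<longleftrightarrow> (\<forall>x\<in>V. S x \<bullet> x \<le> T x \<bullet> x)"

definition opnorm_on :: "'a::real_normed_vector set \<Rightarrow> ('a \<Rightarrow> 'b::real_normed_vector) \<Rightarrow> real" where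
  "opnorm_on V T = (SUP x\<in>{x \<in> V. norm x \<le> 1}. norm (T x))"

definition orth_proj :: "'a::real_inner set \<Rightarrow> 'a \<Rightarrow> 'a" where
  "orth_proj V x = (THE y. y \<in> V \<and> x - y \<in> V\<^sup>\<bottom>)"

(* A_0 is given by its domain D and a function that is relevant on D only. *)

definition densely_defined_selfadjoint :: "'a::real_inner set \<Rightarrow> ('a \<Rightarrow> 'a) \<Rightarrow> bool" where
  "densely_defined_selfadjoint D A \<longleftrightarrow>
     subspace D \<and> linear_on D A \<and> closure D = UNIV \<and>
     (\<forall>x\<in>D. \<forall>y\<in>D. A x \<bullet> y = x \<bullet> A y) \<and>
     {y. \<exists>w. \<forall>x\<in>D. A x \<bullet> y = x \<bullet> w} \<subseteq> D"

definition strictly_positive :: "'a::real_inner set \<Rightarrow> ('a \<Rightarrow> 'a) \<Rightarrow> bool" where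
  "strictly_positive D A \<longleftrightarrow> (\<forall>x\<in>D. x \<noteq> 0 \<longrightarrow> 0 < A x \<bullet> x)"

definition compact_resolvent :: "'a::real_inner set \<Rightarrow> ('a \<Rightarrow> 'a) \<Rightarrow> bool" where
  "compact_resolvent D A \<longleftrightarrow>
     (\<exists>(\<zeta>::real) R.
        bounded_linear R \<and>
        (\<forall>y. R y \<in> D \<and> \<zeta> *\<^sub>R R y - A (R y) = y) \<and>
        (\<forall>x\<in>D. R (\<zeta> *\<^sub>R x - A x) = x) \<and>
        compact (closure (R ` cball 0 1)))"

(* The basis is indexed by j >= 1; the values at index 0 play no role. *)

definition eigenbasis ::
    "'a::real_inner set \<Rightarrow> ('a \<Rightarrow> 'a) \<Rightarrow> (nat \<Rightarrow> 'a) \<Rightarrow> (nat \<Rightarrow> real) \<Rightarrow> bool" where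
  "eigenbasis D A \<phi> ev \<longleftrightarrow>
     (\<forall>j\<ge>1. \<forall>k\<ge>1. \<phi> j \<bullet> \<phi> k = (if j = k then 1 else 0)) \<and>
     closure (span (\<phi> ` {1..})) = UNIV \<and>
     (\<forall>j\<ge>1. \<phi> j \<in> D \<and> A (\<phi> j) = ev j *\<^sub>R \<phi> j) \<and>
     0 < ev 1 \<and> mono_on {1..} ev \<and> filterlim ev at_top sequentially"

definition Xc :: "(nat \<Rightarrow> 'a::real_inner) \<Rightarrow> nat \<Rightarrow> 'a set" where
  "Xc \<phi> N = span (\<phi> ` {1..N})"

definition Xs :: "(nat \<Rightarrow> 'a::real_inner) \<Rightarrow> nat \<Rightarrow> 'a set" where
  "Xs \<phi> N = (Xc \<phi> N)\<^sup>\<bottom>"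

definition PN :: "(nat \<Rightarrow> 'a::real_inner) \<Rightarrow> nat \<Rightarrow> 'a \<Rightarrow> 'a" where
  "PN \<phi> N = orth_proj (Xc \<phi> N)"

definition QN :: "(nat \<Rightarrow> 'a::real_inner) \<Rightarrow> nat \<Rightarrow> 'a \<Rightarrow> 'a" where
  "QN \<phi> N x = x - PN \<phi> N x"

definition Gcc :: "('a \<Rightarrow> 'a) \<Rightarrow> ('a \<Rightarrow>\<^sub>L 'a) \<Rightarrow> (nat \<Rightarrow> 'a::real_inner) \<Rightarrow> nat \<Rightarrow> real \<Rightarrow> 'a \<Rightarrow> 'a" where
  "Gcc A0 L \<phi> N d x = - (d *\<^sub>R A0 x) - PN \<phi> N (L (PN \<phi> N x))"

definition Gcs :: "('a \<Rightarrow>\<^sub>L 'a) \<Rightarrow> (nat \<Rightarrow> 'a::real_inner) \<Rightarrow> nat \<Rightarrow> 'a \<Rightarrow> 'a" where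
  "Gcs L \<phi> N x = - PN \<phi> N (L (QN \<phi> N x))"

definition Gsc :: "('a \<Rightarrow>\<^sub>L 'a) \<Rightarrow> (nat \<Rightarrow> 'a::real_inner) \<Rightarrow> nat \<Rightarrow> 'a \<Rightarrow> 'a" where
  "Gsc L \<phi> N x = - QN \<phi> N (L (PN \<phi> N x))"

definition ell_s :: "('a \<Rightarrow>\<^sub>L 'a) \<Rightarrow> (nat \<Rightarrow> 'a::real_inner) \<Rightarrow> nat \<Rightarrow> real" where
  "ell_s L \<phi> N = (SUP x\<in>{x \<in> Xs \<phi> N. norm x = 1}. (- QN \<phi> N (L (QN \<phi> N x))) \<bullet> x)"

definition gamma_cs ::
    "('a \<Rightarrow>\<^sub>L 'a) \<Rightarrow> (nat \<Rightarrow> 'a::real_inner) \<Rightarrow> nat \<Rightarrow> ('a \<Rightarrow> 'a) \<Rightarrow> real" where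
  "gamma_cs L \<phi> N Pc = opnorm_on (Xs \<phi> N) (\<lambda>x. sqrt_on (Xc \<phi> N) Pc (Gcs L \<phi> N x))"

definition gamma_sc ::
    "('a \<Rightarrow>\<^sub>L 'a) \<Rightarrow> (nat \<Rightarrow> 'a::real_inner) \<Rightarrow> nat \<Rightarrow> ('a \<Rightarrow> 'a) \<Rightarrow> real" where
  "gamma_sc L \<phi> N Pc = opnorm_on (Xc \<phi> N) (\<lambda>x. Gsc L \<phi> N (inv_sqrt_on (Xc \<phi> N) Pc x))"

definition admissible :: "real \<Rightarrow> real \<Rightarrow> (real \<Rightarrow> real) \<Rightarrow> bool" where
  "admissible dmin dmax d \<longleftrightarrow>
     d \<in> borel_measurable (lebesgue_on {0..}) \<and> (\<forall>t\<ge>0. d t \<in> {dmin..dmax})"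

(* The semigroup exp(- \<tau> A_0), written in the eigenbasis. *)

definition heat_semigroup ::
    "(nat \<Rightarrow> 'a::real_inner) \<Rightarrow> (nat \<Rightarrow> real) \<Rightarrow> real \<Rightarrow> 'a \<Rightarrow> 'a" where
  "heat_semigroup \<phi> ev \<tau> x =
     (\<Sum>j. (exp (- ev (Suc j) * \<tau>) * (x \<bullet> \<phi> (Suc j))) *\<^sub>R \<phi> (Suc j))"

(* The operators d(t) A_0 commute, so the evolution family of z' + d(t) A_0 z = 0 is
   exp(- (\<integral>_s^t d) A_0). *)

definition free_evol ::
    "(nat \<Rightarrow> 'a::real_inner) \<Rightarrow> (nat \<Rightarrow> real) \<Rightarrow> (real \<Rightarrow> real) \<Rightarrow> real \<Rightarrow> real \<Rightarrow> 'a \<Rightarrow> 'a" where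
  "free_evol \<phi> ev d t s = heat_semigroup \<phi> ev (LINT r:{s..t}|lebesgue. d r)"

(* Strong solution of z' + d A_0 z + L z = 0 on [s0, \<infinity>): z is locally of class W^{1,1}
   (equivalently, locally absolutely continuous) with weak derivative v, and the equation
   holds almost everywhere. *)

definition strong_solution ::
    "'a set \<Rightarrow> ('a \<Rightarrow> 'a) \<Rightarrow> ('a \<Rightarrow>\<^sub>L 'a) \<Rightarrow> (real \<Rightarrow> real) \<Rightarrow> real \<Rightarrow>
     (real \<Rightarrow> 'a::{real_inner, banach, second_countable_topology}) \<Rightarrow> bool" where
  "strong_solution D A0 L d s0 z \<longleftrightarrow>
     (\<exists>v. (\<forall>t\<ge>s0. set_integrable lebesgue {s0..t} v \<and>
                   z t = z s0 + (LINT r:{s0..t}|lebesgue. v r)) \<and>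
          (AE r in lebesgue. s0 \<le> r \<longrightarrow>
             z r \<in> D \<and> v r + d r *\<^sub>R A0 (z r) + L (z r) = 0))"

(* Mild solution on [s0, \<infinity>): variation of constants with respect to free_evol. *)

definition mild_solution ::
    "(nat \<Rightarrow> 'a) \<Rightarrow> (nat \<Rightarrow> real) \<Rightarrow> ('a \<Rightarrow>\<^sub>L 'a) \<Rightarrow> (real \<Rightarrow> real) \<Rightarrow> real \<Rightarrow>
     (real \<Rightarrow> 'a::{real_inner, banach, second_countable_topology}) \<Rightarrow> bool" where
  "mild_solution \<phi> ev L d s0 z \<longleftrightarrow>
     continuous_on {s0..} z \<and>
     (\<forall>t\<ge>s0. z t = free_evol \<phi> ev d t s0 (z s0)
                    - (LINT r:{s0..t}|lebesgue. free_evol \<phi> ev d t r (L (z r))))"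

definition evolution_family :: "(real \<Rightarrow> real \<Rightarrow> 'a::real_normed_vector \<Rightarrow>\<^sub>L 'a) \<Rightarrow> bool" where
  "evolution_family U \<longleftrightarrow>
     (\<forall>s\<ge>0. U s s = id_blinfun) \<and>
     (\<forall>s r t. 0 \<le> s \<and> s \<le> r \<and> r \<le> t \<longrightarrow> U t r o\<^sub>L U r s = U t s) \<and>
     (\<forall>x. continuous_on {(t, s). 0 \<le> s \<and> s \<le> t} (\<lambda>(t, s). U t s x))"

definition associated_evolution_family ::
    "(nat \<Rightarrow> 'a) \<Rightarrow> (nat \<Rightarrow> real) \<Rightarrow> ('a \<Rightarrow>\<^sub>L 'a) \<Rightarrow> (real \<Rightarrow> real) \<Rightarrow>
     (real \<Rightarrow> real \<Rightarrow> 'a::{real_inner, banach, second_countable_topology} \<Rightarrow>\<^sub>L 'a) \<Rightarrow> bool" where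
  "associated_evolution_family \<phi> ev L d U \<longleftrightarrow>
     evolution_family U \<and> (\<forall>s\<ge>0. \<forall>x. mild_solution \<phi> ev L d s (\<lambda>t. U t s x))"

end

theory Submission
  imports Defs
begin

text \<open>With \<open>z_c = P_N z\<close> and \<open>z_s = Q_N z\<close>, the Lyapunov function is
  \<open>V z = \<langle>\<Pi> z_c, z_c\<rangle> + \<eta> \<parallel>z_s\<parallel>\<^sup>2\<close>. The Lyapunov inequality damps \<open>a = \<parallel>\<Pi>\<^sup>1\<^sup>/\<^sup>2 z_c\<parallel>\<close> at rate
  \<open>\<mu>\<^sub>c\<close>, the spectral gap damps \<open>b = \<parallel>z_s\<parallel>\<close> at rate \<open>\<mu>\<^sub>s\<close>, and the coupling costs at most
  \<open>2 (\<gamma>_cs + \<eta> \<gamma>_sc) a b\<close>; the small-gain condition says exactly that the resulting quadratic form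
  in \<open>(a, b)\<close> is negative definite, so \<open>V' \<le> - 2 \<omega> V\<close>, with \<open>\<omega>\<close> depending only on the constants.
  Strong and mild solutions both satisfy the integrated equation in every coordinate \<open>\<langle>z, \<phi>\<^sub>j\<rangle>\<close>.
  For such weak solutions the energy identity holds for each Galerkin truncation, and
  passing to the limit gives \<open>V(z(t)) \<le> V(z(s)) - 2 \<omega> \<integral>\<^sub>s\<^sup>t V(z(r)) dr\<close>.\<close>

section \<open>Bochner integrals over intervals\<close>

text \<open>Two obstacles shape the proof: a mild solution need not enter the domain of
  \<open>A0\<close>, and \<open>d\<close> is only measurable, so the Lyapunov function cannot be
  differentiated along it directly. In finitely many coordinates both disappear: \<open>A0\<close>
  is a diagonal matrix there and the solution is absolutely continuous. Truncation is harmless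
  because the Lyapunov operator is block diagonal and a multiple of the identity on X_s; hence it
  maps \<open>Xc \<phi> n\<close> into itself once \<open>N \<le> n\<close>. On the high modes
  \<open>d A0\<close> is replaced by its worst case \<open>dmin * ev (N + 1)\<close> before the
  limit is taken, so no convergence of \<open>A0 z\<close> is ever required. The coefficient is
  treated asymmetrically. On X_s positivity of \<open>A0\<close> allows the use of
  \<open>d \<ge> dmin\<close>; on X_c, where \<Pi> and \<open>A0\<close> need not commute,
  \<open>d\<close> multiplies a term without a sign, and the Lyapunov inequality is applied at the
  current value of \<open>d\<close>. The rate \<omega> is an amount by which both margins can be
  lowered while the small-gain inequality survives in non-strict form; \<open>M\<close> comes from
  comparing V with the squared norm.\<close>

lemma set_integral_Icc_split:
  fixes f :: "real \<Rightarrow> 'b::{banach, second_countable_topology}"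
  assumes "set_integrable lebesgue {a..c} f" "a \<le> b" "b \<le> c"
  shows "(LINT r:{a..c}|lebesgue. f r) = (LINT r:{a..b}|lebesgue. f r) + (LINT r:{b..c}|lebesgue. f r)"
proof -
  have "{a..c} = {a..b} \<union> {b..c}" using assms by auto
  moreover have "AE r in lebesgue. \<not> (r \<in> {a..b} \<and> r \<in> {b..c})"
    by (rule AE_I'[of "{b}"]) (use assms in auto)
  moreover have "set_integrable lebesgue {a..b} f" "set_integrable lebesgue {b..c} f"
    using assms by (auto intro: set_integrable_subset[OF assms(1)])
  ultimately show ?thesis
    by (simp add: set_integral_Un_AE)
qed

lemma set_borel_measurable_lebesgue_continuous:
  fixes h :: "real \<Rightarrow> 'b::{banach, second_countable_topology}"
  assumes "continuous_on {a..b} h"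
  shows "set_borel_measurable lebesgue {a..b} h"
  using set_measurable_continuous_on[OF _ assms]
  by (auto simp: set_borel_measurable_def intro!: measurable_completion)

lemma set_integrable_lebesgue_continuous:
  fixes h :: "real \<Rightarrow> 'b::{banach, second_countable_topology}"
  assumes "continuous_on {a..b} h"
  shows "set_integrable lebesgue {a..b} h"
proof -
  have "bounded (h ` {a..b})"
    using assms compact_imp_bounded compact_continuous_image by blast
  then obtain K where K: "\<And>r. r \<in> {a..b} \<Longrightarrow> norm (h r) \<le> K"
    unfolding bounded_iff by blast
  have "set_integrable lebesgue {a..b} (\<lambda>_. K)"
    unfolding set_integrable_def by (intro integrable_scaleR_left integrable_real_indicator) (auto simp: emeasure_lborel_Icc_eq)
  then show ?thesis
    by (rule set_integrable_bound)
       (use K in \<open>force intro!: set_borel_measurable_lebesgue_continuous assms AE_I2\<close>)+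
qed

lemma set_integrable_inner_continuous:
  fixes g h :: "real \<Rightarrow> 'b::{real_inner, banach, second_countable_topology}"
  assumes g: "set_integrable lebesgue {a..b} g" and h: "continuous_on {a..b} h"
  shows "set_integrable lebesgue {a..b} (\<lambda>r. h r \<bullet> g r)"
proof -
  have "bounded (h ` {a..b})"
    using h compact_imp_bounded compact_continuous_image by blast
  then obtain K where K: "\<And>r. r \<in> {a..b} \<Longrightarrow> norm (h r) \<le> K"
    unfolding bounded_iff by blast
  have "set_integrable lebesgue {a..b} (\<lambda>r. K *\<^sub>R g r)"
    using g by simp
  then show ?thesis
  proof (rule set_integrable_bound)
    have "set_borel_measurable lebesgue {a..b} h"
      using h by (rule set_borel_measurable_lebesgue_continuous)
    moreover have "set_borel_measurable lebesgue {a..b} g"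
      using g by (simp add: set_borel_measurable_def set_integrable_def)
    ultimately have "(\<lambda>r. (indicator {a..b} r *\<^sub>R h r) \<bullet> (indicator {a..b} r *\<^sub>R g r)) \<in> borel_measurable lebesgue"
      unfolding set_borel_measurable_def by (rule borel_measurable_inner)
    moreover have "(\<lambda>r. (indicator {a..b} r *\<^sub>R h r) \<bullet> (indicator {a..b} r *\<^sub>R g r))
        = (\<lambda>r. indicator {a..b} r *\<^sub>R (h r \<bullet> g r))"
      by (auto simp: indicator_def)
    ultimately show "set_borel_measurable lebesgue {a..b} (\<lambda>r. h r \<bullet> g r)"
      by (simp add: set_borel_measurable_def)
    show "AE r in lebesgue. r \<in> {a..b} \<longrightarrow> norm (h r \<bullet> g r) \<le> norm (K *\<^sub>R g r)"
    proof (rule AE_I2, rule impI)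
      fix r assume r: "r \<in> {a..b}"
      have "norm (h r \<bullet> g r) \<le> norm (h r) * norm (g r)"
        by (simp add: Cauchy_Schwarz_ineq2)
      also have "\<dots> \<le> \<bar>K\<bar> * norm (g r)"
        using K[OF r] by (intro mult_right_mono) auto
      finally show "norm (h r \<bullet> g r) \<le> norm (K *\<^sub>R g r)" by simp
    qed
  qed
qed

lemma set_integral_const_Icc:
  assumes "a \<le> b"
  shows "(LINT r:{a..b}|lebesgue. (c::real)) = (b - a) * c"
  using assms by (simp add: set_lebesgue_integral_def)

lemma set_integral_inner_left:
  fixes g :: "real \<Rightarrow> 'b::{real_inner, banach, second_countable_topology}"
  assumes "set_integrable lebesgue A g"
  shows "(LINT r:A|lebesgue. c \<bullet> g r) = c \<bullet> (LINT r:A|lebesgue. g r)"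
  using assms integral_inner_right[of c lebesgue "\<lambda>x. indicator A x *\<^sub>R g x"]
  unfolding set_integrable_def set_lebesgue_integral_def
  by simp

text \<open>The library's \<open>set_integral_scaleR_left\<close> asks for integrability on the whole space.\<close>

lemma set_integral_scaleR_vector:
  fixes f :: "'b \<Rightarrow> real" and c :: "'c::{banach, second_countable_topology}"
  assumes "set_integrable M A f"
  shows "(LINT t:A|M. f t *\<^sub>R c) = (LINT t:A|M. f t) *\<^sub>R c"
  using integral_scaleR_left[of c M "\<lambda>t. indicator A t *\<^sub>R f t"] assms
  by (simp add: set_integrable_def set_lebesgue_integral_def)

lemma set_integral_singleton [simp]:
  fixes g :: "real \<Rightarrow> 'b::{banach, second_countable_topology}"
  shows "(LINT r:{a}|lebesgue. g r) = 0"
  unfolding set_lebesgue_integral_def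
  by (rule integral_eq_zero_AE, rule AE_I'[of "{a}"]) (auto simp: indicator_def)

text \<open>The increments of \<open>f\<close> are dominated by those of the primitive of
  \<open>norm (g r)\<close>. That primitive is a real function, continuous as an indefinite gauge
  integral, and \<open>f\<close> inherits its modulus of continuity.\<close>

lemma continuous_on_indefinite_integral:
  fixes g :: "real \<Rightarrow> 'b::{banach, second_countable_topology}"
  assumes g: "set_integrable lebesgue {a..b} g"
    and f: "\<And>t. t \<in> {a..b} \<Longrightarrow> f t = f a + (LINT r:{a..t}|lebesgue. g r)"
  shows "continuous_on {a..b} f"
proof -
  define G where "G t = integral {a..t} (\<lambda>r. norm (g r))" for t
  have gn: "set_integrable lebesgue {a..b} (\<lambda>r. norm (g r))"
    using g by (rule set_integrable_norm)
  have "continuous_on {a..b} G"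
    unfolding G_def by (intro indefinite_integral_continuous_1 set_lebesgue_integral_eq_integral(1) gn)
  have G: "G t - G u = (LINT r:{u..t}|lebesgue. norm (g r))" if "a \<le> u" "u \<le> t" "t \<le> b" for u t
  proof -
    have "set_integrable lebesgue {a..t} (\<lambda>r. norm (g r))" "set_integrable lebesgue {a..u} (\<lambda>r. norm (g r))"
      using that by (auto intro: set_integrable_subset[OF gn])
    then show ?thesis
      using set_integral_Icc_split[of a t "\<lambda>r. norm (g r)" u] that
      by (simp add: G_def set_lebesgue_integral_eq_integral(2))
  qed
  have bd: "norm (f t - f u) \<le> G t - G u" if "a \<le> u" "u \<le> t" "t \<le> b" for u t
  proof -
    have gi: "set_integrable lebesgue {a..t} g" "set_integrable lebesgue {u..t} g"
      using that by (auto intro: set_integrable_subset[OF g])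
    have "f t - f u = (LINT r:{u..t}|lebesgue. g r)"
      using set_integral_Icc_split[OF gi(1), of u] that f[of t] f[of u] by simp
    then show ?thesis
      using set_integral_norm_bound[OF gi(2)] G[OF that] by simp
  qed
  have bd': "dist (f t) (f u) \<le> dist (G t) (G u)" if "t \<in> {a..b}" "u \<in> {a..b}" for t u
    using bd[of u t] bd[of t u] that
    by (cases "u \<le> t") (auto simp: dist_norm norm_minus_commute)
  show ?thesis
    unfolding continuous_on_iff
  proof (intro ballI allI impI)
    fix x e :: real assume "x \<in> {a..b}" "0 < e"
    then obtain d where "d > 0" "\<And>y. y \<in> {a..b} \<Longrightarrow> dist y x < d \<Longrightarrow> dist (G y) (G x) < e"
      using \<open>continuous_on {a..b} G\<close> unfolding continuous_on_iff by metis
    then show "\<exists>d>0. \<forall>y\<in>{a..b}. dist y x < d \<longrightarrow> dist (f y) (f x) < e"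
      using bd' \<open>x \<in> {a..b}\<close> by (intro exI[of _ d]) (meson le_less_trans)
  qed
qed

text \<open>An absolutely continuous function need not be handled through its almost everywhere
  derivative: the increment estimate with error \<open>e * integral of norm g\<close> holds near every point,
  and Bolzano's bisection principle adds it up over the whole interval.\<close>

lemma chain_rule_indefinite_integral:
  fixes f g :: "real \<Rightarrow> 'b::{real_inner, banach, second_countable_topology}"
    and F :: "'b \<Rightarrow> real" and G :: "'b \<Rightarrow> 'b"
  assumes ab: "a \<le> b" and g: "set_integrable lebesgue {a..b} g"
    and f: "\<And>t. t \<in> {a..b} \<Longrightarrow> f t = f a + (LINT r:{a..t}|lebesgue. g r)"
    and dF: "\<And>x. (F has_derivative (\<lambda>h. G x \<bullet> h)) (at x)"
    and G: "continuous_on UNIV G"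
  shows "set_integrable lebesgue {a..b} (\<lambda>r. G (f r) \<bullet> g r)"
    and "F (f b) - F (f a) = (LINT r:{a..b}|lebesgue. G (f r) \<bullet> g r)"
proof -
  have fc: "continuous_on {a..b} f"
    using g f by (rule continuous_on_indefinite_integral)
  have Gc: "continuous_on {a..b} (\<lambda>r. G (f r))"
    using continuous_on_compose2[OF G fc] by simp
  show h: "set_integrable lebesgue {a..b} (\<lambda>r. G (f r) \<bullet> g r)"
    using g Gc by (rule set_integrable_inner_continuous)
  define h where "h = (\<lambda>r. G (f r) \<bullet> g r)"
  define n where "n = (\<lambda>r. norm (g r))"
  have n: "set_integrable lebesgue {a..b} n"
    using g unfolding n_def by (rule set_integrable_norm)
  have sub: "set_integrable lebesgue {u..t} g" "set_integrable lebesgue {u..t} n"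
    "set_integrable lebesgue {u..t} h"
    if "a \<le> u" "t \<le> b" for u t
    using that h unfolding h_def[symmetric] by (auto intro: set_integrable_subset[OF g] set_integrable_subset[OF n] set_integrable_subset[OF h[folded h_def]])
  have fd: "f t - f u = (LINT r:{u..t}|lebesgue. g r)" if "a \<le> u" "u \<le> t" "t \<le> b" for u t
    using set_integral_Icc_split[OF sub(1), of a t u] that f[of t] f[of u] by simp
  have fn: "norm (f t - f u) \<le> (LINT r:{u..t}|lebesgue. n r)" if "a \<le> u" "u \<le> t" "t \<le> b" for u t
    using set_integral_norm_bound[OF sub(1), of u t] fd[OF that] that by (simp add: n_def)
  \<comment> \<open>One \<open>e\<close> pays for the linearization error of \<open>F\<close> at
    \<open>f x\<close>, the other for replacing \<open>G (f r)\<close> by \<open>G (f x)\<close>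
    under the integral.\<close>
  have main: "\<bar>F (f b) - F (f a) - (LINT r:{a..b}|lebesgue. h r)\<bar> \<le> 2 * e * (LINT r:{a..b}|lebesgue. n r)"
    if e: "e > 0" for e
  proof -
    \<comment> \<open>The guards are needed because the local case of Bolzano's principle also
      ranges over intervals that stick out of \<open>{a..b}\<close>.\<close>
    define P where "P u t \<longleftrightarrow> (a \<le> u \<longrightarrow> t \<le> b \<longrightarrow>
      \<bar>F (f t) - F (f u) - (LINT r:{u..t}|lebesgue. h r)\<bar> \<le> 2 * e * (LINT r:{u..t}|lebesgue. n r))" for u t
    have "P a b"
      using ab
    proof (induction rule: Bolzano)
      case (trans u x t)
      show ?case
        unfolding P_def
      proof (intro impI)
        assume ut: "a \<le> u" "t \<le> b"
        have "(LINT r:{u..t}|lebesgue. h r) = (LINT r:{u..x}|lebesgue. h r) + (LINT r:{x..t}|lebesgue. h r)"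
          "(LINT r:{u..t}|lebesgue. n r) = (LINT r:{u..x}|lebesgue. n r) + (LINT r:{x..t}|lebesgue. n r)"
          using trans ut sub by (auto intro!: set_integral_Icc_split)
        moreover have "\<bar>F (f x) - F (f u) - (LINT r:{u..x}|lebesgue. h r)\<bar> \<le> 2 * e * (LINT r:{u..x}|lebesgue. n r)"
          "\<bar>F (f t) - F (f x) - (LINT r:{x..t}|lebesgue. h r)\<bar> \<le> 2 * e * (LINT r:{x..t}|lebesgue. n r)"
          using trans ut by (auto simp: P_def)
        ultimately show "\<bar>F (f t) - F (f u) - (LINT r:{u..t}|lebesgue. h r)\<bar> \<le> 2 * e * (LINT r:{u..t}|lebesgue. n r)"
          by (simp add: distrib_left)
      qed
    next
      case (local x)
      obtain d1 where d1: "d1 > 0" "\<And>y. norm (y - f x) < d1 \<Longrightarrow>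
          \<bar>F y - F (f x) - G (f x) \<bullet> (y - f x)\<bar> \<le> e * norm (y - f x)"
        using dF[of "f x"] e unfolding has_derivative_at_alt by (metis real_norm_def)
      obtain d2 where d2: "d2 > 0" "\<And>y. y \<in> {a..b} \<Longrightarrow> dist y x < d2 \<Longrightarrow> dist (f y) (f x) < d1"
        using fc local d1(1) unfolding continuous_on_iff by (metis atLeastAtMost_iff)
      obtain d3 where d3: "d3 > 0" "\<And>y. y \<in> {a..b} \<Longrightarrow> dist y x < d3 \<Longrightarrow> dist (G (f y)) (G (f x)) < e"
        using Gc local e unfolding continuous_on_iff by (metis atLeastAtMost_iff)
      have "P u t" if ut: "u \<le> x" "x \<le> t" "t - u < min d2 d3" for u t
        unfolding P_def
      proof (intro impI)
        assume *: "a \<le> u" "t \<le> b"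
        have 1: "\<bar>F (f t) - F (f x) - G (f x) \<bullet> (f t - f x)\<bar> \<le> e * (LINT r:{x..t}|lebesgue. n r)"
        proof -
          have "norm (f t - f x) < d1" using d2(2)[of t] ut * by (simp add: dist_norm)
          from d1(2)[OF this] show ?thesis
            using mult_left_mono[OF fn[of x t], of e] ut * local e by linarith
        qed
        have 2: "\<bar>F (f u) - F (f x) - G (f x) \<bullet> (f u - f x)\<bar> \<le> e * (LINT r:{u..x}|lebesgue. n r)"
        proof -
          have "norm (f u - f x) < d1" using d2(2)[of u] ut * by (simp add: dist_norm)
          from d1(2)[OF this] show ?thesis
            using mult_left_mono[OF fn[of u x], of e] ut * local e
            unfolding norm_minus_commute[of "f x" "f u"] by linarith
        qed
        have 3: "\<bar>G (f x) \<bullet> (f t - f u) - (LINT r:{u..t}|lebesgue. h r)\<bar> \<le> e * (LINT r:{u..t}|lebesgue. n r)"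
        proof -
          have gi: "set_integrable lebesgue {u..t} (\<lambda>r. G (f x) \<bullet> g r)"
            using sub(1)[OF *] by (rule set_integrable_inner_continuous) simp
          have "G (f x) \<bullet> (f t - f u) = (LINT r:{u..t}|lebesgue. G (f x) \<bullet> g r)"
            using fd[of u t] set_integral_inner_left[OF sub(1)[OF *], of "G (f x)"] ut * by simp
          then have "G (f x) \<bullet> (f t - f u) - (LINT r:{u..t}|lebesgue. h r)
              = (LINT r:{u..t}|lebesgue. G (f x) \<bullet> g r - h r)"
            using gi sub(3)[OF *] by simp
          moreover have "\<bar>LINT r:{u..t}|lebesgue. G (f x) \<bullet> g r - h r\<bar>
              \<le> (LINT r:{u..t}|lebesgue. \<bar>G (f x) \<bullet> g r - h r\<bar>)"
            using set_integral_norm_bound[OF set_integral_diff(1)[OF gi sub(3)[OF *]]] by simp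
          moreover have "\<dots> \<le> (LINT r:{u..t}|lebesgue. e * n r)"
          proof (rule set_integral_mono)
            show "set_integrable lebesgue {u..t} (\<lambda>r. \<bar>G (f x) \<bullet> g r - h r\<bar>)"
              using gi sub(3)[OF *] by (intro set_integrable_abs set_integral_diff)
            show "set_integrable lebesgue {u..t} (\<lambda>r. e * n r)"
              using sub(2)[OF *] by simp
            fix r assume r: "r \<in> {u..t}"
            have "dist (G (f r)) (G (f x)) < e"
              using r ut * by (intro d3(2)) (auto simp: dist_real_def)
            then have "norm (G (f x) - G (f r)) \<le> e" by (simp add: dist_norm norm_minus_commute)
            then show "\<bar>G (f x) \<bullet> g r - h r\<bar> \<le> e * n r"
              unfolding h_def n_def inner_diff_left[symmetric]
              by (meson Cauchy_Schwarz_ineq2 mult_right_mono norm_ge_zero order_trans)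
          qed
          ultimately show ?thesis using sub(2)[OF *] by simp
        qed
        have "(LINT r:{u..t}|lebesgue. n r) = (LINT r:{u..x}|lebesgue. n r) + (LINT r:{x..t}|lebesgue. n r)"
          using ut * sub by (auto intro!: set_integral_Icc_split)
        then have "2 * e * (LINT r:{u..t}|lebesgue. n r)
            = e * (LINT r:{u..x}|lebesgue. n r) + e * (LINT r:{x..t}|lebesgue. n r) + e * (LINT r:{u..t}|lebesgue. n r)"
          by (simp add: algebra_simps)
        moreover have "G (f x) \<bullet> (f t - f u) = G (f x) \<bullet> (f t - f x) - G (f x) \<bullet> (f u - f x)"
          by (simp add: inner_diff_right)
        ultimately show "\<bar>F (f t) - F (f u) - (LINT r:{u..t}|lebesgue. h r)\<bar> \<le> 2 * e * (LINT r:{u..t}|lebesgue. n r)"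
          using 1 2 3 by linarith
      qed
      then show ?case using d2(1) d3(1) by (intro exI[of _ "min d2 d3"]) auto
    qed
    then show ?thesis by (simp add: P_def)
  qed
  have "\<bar>F (f b) - F (f a) - (LINT r:{a..b}|lebesgue. h r)\<bar> \<le> 0"
  proof (rule tendsto_lowerbound)
    show "((\<lambda>e. 2 * e * (LINT r:{a..b}|lebesgue. n r)) \<longlongrightarrow> 0) (at_right 0)"
      by (auto intro!: tendsto_eq_intros)
    show "\<forall>\<^sub>F e in at_right 0. \<bar>F (f b) - F (f a) - (LINT r:{a..b}|lebesgue. h r)\<bar> \<le> 2 * e * (LINT r:{a..b}|lebesgue. n r)"
      using main eventually_at_right_less[of 0] by (auto elim: eventually_mono)
  qed simp
  then show "F (f b) - F (f a) = (LINT r:{a..b}|lebesgue. G (f r) \<bullet> g r)"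
    by (simp add: h_def)
qed

section \<open>Self-adjoint operators on finite-dimensional subspaces\<close>

lemma linear_on_0: "linear_on V T \<Longrightarrow> subspace V \<Longrightarrow> T 0 = 0"
  unfolding linear_on_def by (metis scaleR_zero_left subspace_0)

lemma linear_on_sum:
  assumes "linear_on V T" "subspace V" "\<And>i. i \<in> I \<Longrightarrow> v i \<in> V"
  shows "T (\<Sum>i\<in>I. c i *\<^sub>R v i) = (\<Sum>i\<in>I. c i *\<^sub>R T (v i))"
  using assms(3)
proof (induction I rule: infinite_finite_induct)
  case (insert i I)
  have "(\<Sum>i\<in>I. c i *\<^sub>R v i) \<in> V" "c i *\<^sub>R v i \<in> V" "v i \<in> V"
    using insert.prems assms(2) by (auto intro!: subspace_sum subspace_scale)
  then show ?case
    using insert assms(1) by (simp add: linear_on_def)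
qed (use linear_on_0[OF assms(1,2)] in auto)

text \<open>Sets instead of families, because the eigenvectors below are collected in a set of
  maximal cardinality that is tested by \<open>insert\<close>.\<close>

definition orthonormal_set :: "'a::real_inner set \<Rightarrow> bool" where
  "orthonormal_set B \<longleftrightarrow> (\<forall>x\<in>B. \<forall>y\<in>B. x \<bullet> y = (if x = y then 1 else 0))"

lemma orthonormal_set_norm: "orthonormal_set B \<Longrightarrow> b \<in> B \<Longrightarrow> norm b = 1"
  by (simp add: orthonormal_set_def norm_eq_1)

lemma orthonormal_set_independent: "orthonormal_set B \<Longrightarrow> independent B"
  by (rule pairwise_orthogonal_independent)
     (force simp: orthonormal_set_def pairwise_def orthogonal_def)+

lemma inner_sum_orthonormal:
  assumes "finite B" "orthonormal_set B" "b \<in> B"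
  shows "(\<Sum>e\<in>B. c e *\<^sub>R e) \<bullet> b = c b"
proof -
  have "(\<Sum>e\<in>B. c e *\<^sub>R e) \<bullet> b = (\<Sum>e\<in>B. if e = b then c e else 0)"
    unfolding inner_sum_left using assms by (intro sum.cong) (auto simp: orthonormal_set_def)
  then show ?thesis using assms by simp
qed

lemma linear_combination_in_span: "(\<Sum>b\<in>B. c b *\<^sub>R b) \<in> span B"
  by (intro span_sum span_scale span_base)

lemma orthonormal_expansion:
  assumes B: "finite B" "orthonormal_set B" and x: "x \<in> span B"
  shows "(\<Sum>b\<in>B. (x \<bullet> b) *\<^sub>R b) = x"
proof -
  define S where "S = {x. (\<Sum>b\<in>B. (x \<bullet> b) *\<^sub>R b) = x}"
  have "subspace S"
  proof (rule subspaceI)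
    fix c x assume "x \<in> S"
    have "(\<Sum>b\<in>B. (c *\<^sub>R x \<bullet> b) *\<^sub>R b) = c *\<^sub>R (\<Sum>b\<in>B. (x \<bullet> b) *\<^sub>R b)"
      by (simp add: scaleR_sum_right)
    also have "\<dots> = c *\<^sub>R x" using \<open>x \<in> S\<close> by (simp add: S_def)
    finally show "c *\<^sub>R x \<in> S" by (simp add: S_def)
  qed (auto simp: S_def inner_add_left scaleR_add_left sum.distrib)
  moreover have "B \<subseteq> S"
  proof
    fix e assume e: "e \<in> B"
    have "(\<Sum>b\<in>B. (e \<bullet> b) *\<^sub>R b) = (\<Sum>b\<in>B. if b = e then b else 0)"
      using B e by (intro sum.cong) (auto simp: orthonormal_set_def)
    then show "e \<in> S" using B e by (simp add: S_def)
  qed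
  ultimately show ?thesis using span_minimal[of B S] x by (auto simp: S_def)
qed

lemma linear_on_span_eq_sum:
  assumes "finite B" "orthonormal_set B" "linear_on (span B) T" "x \<in> span B"
  shows "T x = (\<Sum>b\<in>B. (x \<bullet> b) *\<^sub>R T b)"
  using linear_on_sum[OF assms(3) subspace_span, of B "\<lambda>b. b" "\<lambda>b. x \<bullet> b"]
    orthonormal_expansion[OF assms(1,2,4)] by (simp add: span_base)

lemma bounded_linear_finite_sum:
  "bounded_linear (\<lambda>x::'a::real_inner. \<Sum>i\<in>I. (x \<bullet> u i) *\<^sub>R (v i :: 'b::real_normed_vector))"
  by (intro bounded_linear_sum bounded_linear_scaleR_left[THEN bounded_linear_compose]
      bounded_linear_inner_left)

text \<open>The ambient space may be infinite-dimensional, so closed and bounded is not enough. The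
  sphere is a closed part of \<open>K B\<close>, the combinations with coefficients in
  \<open>{-1..1}\<close>, which is compact by induction on \<open>B\<close>; Cauchy-Schwarz puts the
  coefficients of a unit vector in that range.\<close>

lemma compact_span_sphere:
  fixes B :: "'a::real_inner set"
  assumes B: "finite B" "orthonormal_set B"
  shows "compact {x \<in> span B. norm x = 1}"
proof -
  define K where "K A = {\<Sum>b\<in>A. c b *\<^sub>R b |c. \<forall>b\<in>A. c b \<in> {-1..1::real}}" for A :: "'a set"
  have cK: "compact (K A)" if "finite A" for A
    using that
  proof induction
    case empty
    have "K {} = {0}" by (auto simp: K_def)
    then show ?case by simp
  next
    case (insert b A)
    have "K (insert b A) = (\<lambda>(c, x). c *\<^sub>R b + x) ` ({-1..1} \<times> K A)"
    proof (intro equalityI subsetI)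
      fix x assume "x \<in> K (insert b A)"
      then obtain c where c: "\<forall>e\<in>insert b A. c e \<in> {-1..1::real}" "x = (\<Sum>e\<in>insert b A. c e *\<^sub>R e)"
        by (auto simp: K_def)
      have "(\<Sum>e\<in>A. c e *\<^sub>R e) \<in> K A" using c unfolding K_def by blast
      then show "x \<in> (\<lambda>(c, x). c *\<^sub>R b + x) ` ({-1..1} \<times> K A)"
        using c insert by (intro image_eqI[of _ _ "(c b, \<Sum>e\<in>A. c e *\<^sub>R e)"]) auto
    next
      fix x assume "x \<in> (\<lambda>(c, x). c *\<^sub>R b + x) ` ({-1..1} \<times> K A)"
      then obtain k c where c: "\<forall>e\<in>A. c e \<in> {-1..1::real}" "k \<in> {-1..1::real}"
          "x = k *\<^sub>R b + (\<Sum>e\<in>A. c e *\<^sub>R e)"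
        by (auto simp: K_def)
      have "(\<Sum>e\<in>A. c e *\<^sub>R e) = (\<Sum>e\<in>A. (if e = b then k else c e) *\<^sub>R e)"
        using insert by (intro sum.cong) auto
      then have "x = (\<Sum>e\<in>insert b A. (if e = b then k else c e) *\<^sub>R e)"
        using insert c by simp
      then show "x \<in> K (insert b A)"
        unfolding K_def using c by (intro CollectI exI[of _ "\<lambda>e. if e = b then k else c e"]) auto
    qed
    moreover have "compact ((\<lambda>(c, x). c *\<^sub>R b + x) ` ({-1..1::real} \<times> K A))"
      using insert by (intro compact_continuous_image compact_Times)
        (auto simp: case_prod_unfold intro!: continuous_intros)
    ultimately show ?case by simp
  qed
  have "{x \<in> span B. norm x = 1} = K B \<inter> {x. norm x = 1}"
  proof (intro equalityI subsetI)
    fix x assume x: "x \<in> {x \<in> span B. norm x = 1}"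
    have "x \<bullet> b \<in> {-1..1}" if "b \<in> B" for b
      using Cauchy_Schwarz_ineq2[of x b] x orthonormal_set_norm[OF B(2) that] by auto
    then show "x \<in> K B \<inter> {x. norm x = 1}"
      using orthonormal_expansion[OF B, of x] x unfolding K_def
      by (auto intro!: exI[of _ "\<lambda>b. x \<bullet> b"])
  next
    fix x assume "x \<in> K B \<inter> {x. norm x = 1}"
    then show "x \<in> {x \<in> span B. norm x = 1}"
      by (auto simp: K_def intro!: linear_combination_in_span)
  qed
  moreover have "closed {x::'a. norm x = 1}"
    by (intro closed_Collect_eq continuous_intros)
  ultimately show ?thesis using compact_Int_closed[OF cK[OF B(1)]] by simp
qed

text \<open>A maximizer \<open>e\<close> of the Rayleigh quotient on the compact unit sphere is an
  eigenvector: the first variation vanishes in every direction of \<open>W\<close>, so the residual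
  \<open>T e - m *\<^sub>R e\<close> is orthogonal to \<open>W\<close>, while it also lies in
  \<open>W\<close>.\<close>

lemma symmetric_eigenvector_exists:
  fixes W :: "'a::real_inner set"
  assumes W: "subspace W" "compact {x \<in> W. norm x = 1}" "w \<in> W" "w \<noteq> 0"
    and T: "linear_on W T" "T ` W \<subseteq> W" "continuous_on W T"
    and sym: "\<And>x y. x \<in> W \<Longrightarrow> y \<in> W \<Longrightarrow> T x \<bullet> y = x \<bullet> T y"
  obtains e m where "e \<in> W" "norm e = 1" "T e = m *\<^sub>R e"
proof -
  let ?S = "{x \<in> W. norm x = 1}"
  have "(1 / norm w) *\<^sub>R w \<in> ?S"
    using W by (auto intro: subspace_scale)
  then have "?S \<noteq> {}" by blast
  moreover have "continuous_on ?S (\<lambda>x. T x \<bullet> x)"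
    by (intro continuous_intros continuous_on_subset[OF T(3)]) auto
  ultimately obtain e where e: "e \<in> ?S" and max: "\<And>x. x \<in> ?S \<Longrightarrow> T x \<bullet> x \<le> T e \<bullet> e"
    using continuous_attains_sup[OF W(2)] by blast
  define m where "m = T e \<bullet> e"
  have eW: "e \<in> W" "norm e = 1" using e by auto
  have q: "T x \<bullet> x \<le> m * (norm x)\<^sup>2" if x: "x \<in> W" for x
  proof (cases "x = 0")
    case False
    have "(1 / norm x) *\<^sub>R x \<in> ?S" using False x W by (auto intro: subspace_scale)
    from max[OF this] have "(1 / norm x)\<^sup>2 * (T x \<bullet> x) \<le> m"
      using T(1) x by (simp add: linear_on_def m_def power2_eq_square)
    then show ?thesis using False by (simp add: power_divide field_simps)
  qed (use linear_on_0[OF T(1) W(1)] in simp)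
  have orth: "(T e - m *\<^sub>R e) \<bullet> y = 0" if y: "y \<in> W" for y
  proof (rule ccontr)
    let ?a = "(T e - m *\<^sub>R e) \<bullet> y" and ?b = "m * (y \<bullet> y) - T y \<bullet> y"
    assume a: "?a \<noteq> 0"
    have ineq: "2 * s * ?a \<le> s\<^sup>2 * ?b" for s
    proof -
      have "T (e + s *\<^sub>R y) = T e + s *\<^sub>R T y"
        using T(1) eW y W(1) by (simp add: linear_on_def subspace_scale)
      moreover have "e + s *\<^sub>R y \<in> W" using eW y W(1) by (simp add: subspace_add subspace_scale)
      ultimately have "(T e + s *\<^sub>R T y) \<bullet> (e + s *\<^sub>R y) \<le> m * ((e + s *\<^sub>R y) \<bullet> (e + s *\<^sub>R y))"
        using q[of "e + s *\<^sub>R y"] by (simp add: power2_norm_eq_inner)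
      moreover have "e \<bullet> e = 1" using eW by (simp add: norm_eq_1)
      moreover have "T y \<bullet> e = T e \<bullet> y" using sym[OF y eW(1)] by (simp add: inner_commute)
      ultimately show ?thesis
        using m_def by (simp add: algebra_simps power2_eq_square inner_commute)
    qed
    have "?b \<ge> 0" using q[OF y] by (simp add: power2_norm_eq_inner)
    \<comment> \<open>The left side of \<open>ineq\<close> is linear in \<open>s\<close> and the
      right side quadratic, so a small \<open>s\<close> with the sign of \<open>?a\<close>
      contradicts it. The summand 1 keeps the denominator positive when
      \<open>?b = 0\<close>.\<close>
    define s where "s = ?a / (?b + 1)"
    have "2 * ?a\<^sup>2 / (?b + 1) \<le> ?a\<^sup>2 / (?b + 1) * (?b / (?b + 1))"
      using ineq[of s] by (simp add: s_def power2_eq_square)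
    also have "\<dots> \<le> ?a\<^sup>2 / (?b + 1) * 1"
      using \<open>?b \<ge> 0\<close> by (intro mult_left_mono) auto
    finally have "?a\<^sup>2 / (?b + 1) \<le> 0" by (simp add: field_simps)
    moreover have "?a\<^sup>2 / (?b + 1) > 0" using a \<open>?b \<ge> 0\<close> by (intro divide_pos_pos) auto
    ultimately show False by simp
  qed
  have "T e - m *\<^sub>R e \<in> W" using T(2) eW W(1) by (auto intro!: subspace_diff subspace_scale)
  from orth[OF this] have "T e = m *\<^sub>R e" by simp
  with eW show ?thesis by (rule that)
qed

text \<open>Take an orthonormal set of eigenvectors of largest cardinality, which exists because
  independence bounds the cardinality by \<open>card B\<close>. If it did not span, its orthogonal
  complement inside \<open>span B\<close> would be nonzero and, by symmetry, invariant under
  \<open>T\<close>, so it would contain a further unit eigenvector.\<close>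

lemma spectral_theorem_span:
  fixes B :: "'a::real_inner set"
  assumes B: "finite B" "orthonormal_set B"
    and T: "linear_on (span B) T" "T ` span B \<subseteq> span B"
    and sym: "\<And>x y. x \<in> span B \<Longrightarrow> y \<in> span B \<Longrightarrow> T x \<bullet> y = x \<bullet> T y"
  obtains E m where "finite E" "orthonormal_set E" "span E = span B"
    "\<And>e. e \<in> E \<Longrightarrow> T e = m e *\<^sub>R e"
proof -
  define P where "P E \<longleftrightarrow> E \<subseteq> span B \<and> orthonormal_set E \<and> (\<forall>e\<in>E. \<exists>m. T e = m *\<^sub>R e)" for E
  have bd: "finite E \<and> card E \<le> card B" if "P E" for E
    using that independent_span_bound[OF B(1), of E] by (auto simp: P_def orthonormal_set_independent)
  have "P {}" by (simp add: P_def orthonormal_set_def)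
  then obtain E where E: "P E" and max: "\<And>E'. P E' \<Longrightarrow> card E' \<le> card E"
    using ex_has_greatest_nat[of P "{}" card "Suc (card B)"] bd by (auto simp: less_Suc_eq_le)
  have finE: "finite E" and onE: "orthonormal_set E" and subE: "E \<subseteq> span B"
    using E bd by (auto simp: P_def)
  have "span E = span B"
  proof (rule ccontr)
    assume "span E \<noteq> span B"
    moreover have spE: "span E \<subseteq> span B" using subE by (simp add: span_minimal)
    ultimately obtain x where x: "x \<in> span B" "x \<notin> span E" by blast
    define p where "p = (\<Sum>e\<in>E. (x \<bullet> e) *\<^sub>R e)"
    define W where "W = {w \<in> span B. \<forall>e\<in>E. w \<bullet> e = 0}"
    have p: "p \<in> span E" unfolding p_def by (rule linear_combination_in_span)
    have xW: "x - p \<in> W"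
      unfolding W_def using inner_sum_orthonormal[OF finE onE] p spE x
      by (auto simp: inner_diff_left p_def intro!: span_diff)
    have x0: "x - p \<noteq> 0" using p x by auto
    have sW: "subspace W"
      by (auto simp: W_def subspace_def inner_add_left span_zero span_add span_scale)
    have cW: "compact {x \<in> W. norm x = 1}"
    proof -
      have "{x \<in> W. norm x = 1} = {x \<in> span B. norm x = 1} \<inter> (\<Inter>e\<in>E. {x. x \<bullet> e = 0})"
        by (auto simp: W_def)
      moreover have "closed (\<Inter>e\<in>E. {x. x \<bullet> e = 0})"
        by (intro closed_INT ballI closed_Collect_eq continuous_intros)
      ultimately show ?thesis using compact_span_sphere[OF B] by (simp add: compact_Int_closed)
    qed
    have lW: "linear_on W T" using T(1) by (auto simp: linear_on_def W_def)
    have iW: "T ` W \<subseteq> W"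
    proof (intro image_subsetI)
      fix w assume w: "w \<in> W"
      have "T w \<bullet> e = 0" if e: "e \<in> E" for e
      proof -
        obtain m where "T e = m *\<^sub>R e" using E e by (auto simp: P_def)
        then show ?thesis using sym[of w e] w e subE by (auto simp: W_def)
      qed
      then show "T w \<in> W" using w T(2) by (auto simp: W_def)
    qed
    have oW: "continuous_on W T"
    proof (subst continuous_on_cong[OF refl])
      show "T x = (\<Sum>b\<in>B. (x \<bullet> b) *\<^sub>R T b)" if "x \<in> W" for x
        using linear_on_span_eq_sum[OF B T(1)] that by (simp add: W_def)
    qed (intro continuous_intros)
    have yW: "T x \<bullet> y = x \<bullet> T y" if "x \<in> W" "y \<in> W" for x y
      using sym that by (simp add: W_def)
    obtain e m where e: "e \<in> W" "norm e = 1" "T e = m *\<^sub>R e"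
      by (rule symmetric_eigenvector_exists[OF sW cW xW x0 lW iW oW yW])
    have "e \<notin> E" using e by (auto simp: W_def)
    moreover have "P (insert e E)"
      using e E by (auto simp: P_def W_def orthonormal_set_def norm_eq_1 inner_commute)
    ultimately show False using max[of "insert e E"] finE by simp
  qed
  moreover obtain m where "\<And>e. e \<in> E \<Longrightarrow> T e = m e *\<^sub>R e"
    using E unfolding P_def by metis
  ultimately show ?thesis using that finE onE by blast
qed

lemma posdef_spectral_span:
  fixes B :: "'a::real_inner set"
  assumes B: "finite B" "orthonormal_set B" and T: "selfadjoint_posdef_on (span B) T"
  obtains E m where "finite E" "orthonormal_set E" "span E = span B"
    "\<And>e. e \<in> E \<Longrightarrow> T e = m e *\<^sub>R e" "\<And>e. e \<in> E \<Longrightarrow> 0 < m e"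
proof -
  have T': "linear_on (span B) T" "T ` span B \<subseteq> span B"
    "\<And>x y. x \<in> span B \<Longrightarrow> y \<in> span B \<Longrightarrow> T x \<bullet> y = x \<bullet> T y"
    "\<And>x. x \<in> span B \<Longrightarrow> x \<noteq> 0 \<Longrightarrow> 0 < T x \<bullet> x"
    using T by (auto simp: selfadjoint_posdef_on_def)
  obtain E m where E: "finite E" "orthonormal_set E" "span E = span B" "\<And>e. e \<in> E \<Longrightarrow> T e = m e *\<^sub>R e"
    by (rule spectral_theorem_span[OF B T'(1,2)]) (rule T'(3), assumption, assumption, rule that)
  have "m e > 0" if "e \<in> E" for e
  proof -
    have "norm e = 1" by (rule orthonormal_set_norm[OF E(2) that])
    moreover have "e \<in> span B" unfolding E(3)[symmetric] using that by (rule span_base)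
    ultimately have "0 < T e \<bullet> e" "e \<bullet> e = 1" using T'(4)[of e] by (cases "e = 0"; simp add: norm_eq_1)+
    then show ?thesis by (simp add: E(4)[OF that])
  qed
  with E show ?thesis by (rule that)
qed

text \<open>\<open>sqrt_on\<close> is a \<open>SOME\<close> term, so its defining properties hold
  only once a root is exhibited. The root takes square roots of the eigenvalues.\<close>

lemma posdef_sqrt_exists:
  fixes B :: "'a::real_inner set"
  assumes B: "finite B" "orthonormal_set B" and T: "selfadjoint_posdef_on (span B) T"
  shows "\<exists>R. selfadjoint_posdef_on (span B) R \<and> (\<forall>x\<in>span B. R (R x) = T x)"
proof -
  obtain E m where E: "finite E" "orthonormal_set E" "span E = span B" "\<And>e. e \<in> E \<Longrightarrow> T e = m e *\<^sub>R e"
    and m: "\<And>e. e \<in> E \<Longrightarrow> 0 < m e"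
    by (rule posdef_spectral_span[OF B T]) (rule that)
  define R where "R x = (\<Sum>e\<in>E. (sqrt (m e) * (x \<bullet> e)) *\<^sub>R e)" for x
  have Re: "R x \<bullet> e = sqrt (m e) * (x \<bullet> e)" if "e \<in> E" for x e
    unfolding R_def by (rule inner_sum_orthonormal[OF E(1,2) that])
  have Rin: "R x \<bullet> y = (\<Sum>e\<in>E. sqrt (m e) * (x \<bullet> e) * (y \<bullet> e))" for x y
    unfolding R_def inner_sum_left by (intro sum.cong) (simp_all add: inner_commute)
  have "R ` span B \<subseteq> span B"
    unfolding E(3)[symmetric] R_def by (intro image_subsetI linear_combination_in_span)
  moreover have "linear_on (span B) R"
    unfolding linear_on_def R_def
    by (auto simp: inner_add_left algebra_simps sum.distrib scaleR_sum_right)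
  moreover have "R x \<bullet> y = x \<bullet> R y" for x y
    unfolding inner_commute[of x "R y"] Rin by (simp add: mult_ac)
  moreover have "0 < R x \<bullet> x" if x: "x \<in> span B" "x \<noteq> 0" for x
  proof -
    have "\<exists>e\<in>E. x \<bullet> e \<noteq> 0"
    proof (rule ccontr)
      assume "\<not> ?thesis"
      then have "(\<Sum>e\<in>E. (x \<bullet> e) *\<^sub>R e) = 0" by simp
      then show False using orthonormal_expansion[OF E(1,2), of x] x E(3) by simp
    qed
    then obtain e where e: "e \<in> E" "x \<bullet> e \<noteq> 0" by blast
    have "R x \<bullet> x = (\<Sum>e\<in>E. sqrt (m e) * (x \<bullet> e)\<^sup>2)"
      by (simp add: Rin power2_eq_square mult_ac)
    also have "\<dots> > 0"
      using e m by (intro sum_pos2[OF E(1) e(1)]) (auto simp: less_imp_le)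
    finally show ?thesis .
  qed
  moreover have "R (R x) = T x" if x: "x \<in> span B" for x
  proof -
    have "linear_on (span E) T" using T E(3) by (simp add: selfadjoint_posdef_on_def)
    then have "T x = (\<Sum>e\<in>E. (x \<bullet> e) *\<^sub>R T e)"
      using linear_on_span_eq_sum[OF E(1,2)] x E(3) by simp
    also have "\<dots> = (\<Sum>e\<in>E. (sqrt (m e) * (R x \<bullet> e)) *\<^sub>R e)"
      using m by (intro sum.cong refl) (simp add: E(4) Re less_imp_le flip: mult.assoc)
    finally show ?thesis by (simp add: R_def[of "R x"])
  qed
  ultimately have "selfadjoint_posdef_on (span B) R \<and> (\<forall>x\<in>span B. R (R x) = T x)"
    by (simp add: selfadjoint_posdef_on_def)
  then show ?thesis by (intro exI[of _ R])
qed

text \<open>The inverse is written through coefficients in the eigenvector basis, which extends it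
  by zero on the orthogonal complement. Being bounded and linear on the whole space, it can be
  composed with other operators without side conditions.\<close>

lemma posdef_bounded_inverse:
  fixes B :: "'a::real_inner set"
  assumes B: "finite B" "orthonormal_set B" and T: "selfadjoint_posdef_on (span B) T"
  obtains S where "bounded_linear S" "\<And>x. x \<in> span B \<Longrightarrow> S x \<in> span B"
    "\<And>x. x \<in> span B \<Longrightarrow> S (T x) = x" "\<And>x. x \<in> span B \<Longrightarrow> T (S x) = x"
proof -
  obtain E m where E: "finite E" "orthonormal_set E" "span E = span B" "\<And>e. e \<in> E \<Longrightarrow> T e = m e *\<^sub>R e"
    and m: "\<And>e. e \<in> E \<Longrightarrow> 0 < m e"
    by (rule posdef_spectral_span[OF B T]) (rule that)
  have m0: "m e \<noteq> 0" if "e \<in> E" for e using m[OF that] by simp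
  define S where "S x = (\<Sum>e\<in>E. (x \<bullet> e) *\<^sub>R ((1 / m e) *\<^sub>R e))" for x
  have Tx: "T x = (\<Sum>e\<in>E. ((x \<bullet> e) * m e) *\<^sub>R e)" if "x \<in> span B" for x
    using linear_on_span_eq_sum[OF E(1,2), of T x] T that E(3,4)
    by (simp add: selfadjoint_posdef_on_def)
  have Sx: "S x \<in> span B" for x
    unfolding E(3)[symmetric] S_def scaleR_scaleR by (rule linear_combination_in_span)
  have Se: "S x \<bullet> e = (x \<bullet> e) / m e" if "e \<in> E" for x e
    using inner_sum_orthonormal[OF E(1,2) that, of "\<lambda>e. (x \<bullet> e) / m e"] by (simp add: S_def)
  show ?thesis
  proof (rule that)
    show "bounded_linear S" unfolding S_def by (rule bounded_linear_finite_sum)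
    fix x assume x: "x \<in> span B"
    show "S x \<in> span B" by (rule Sx)
    have "T x \<bullet> e = (x \<bullet> e) * m e" if "e \<in> E" for e
      using inner_sum_orthonormal[OF E(1,2) that, of "\<lambda>e. (x \<bullet> e) * m e"] by (simp add: Tx[OF x])
    then have "S (T x) = (\<Sum>e\<in>E. (x \<bullet> e) *\<^sub>R e)"
      unfolding S_def by (intro sum.cong refl) (simp add: m0)
    then show "S (T x) = x" using orthonormal_expansion[OF E(1,2)] x E(3) by simp
    have "T (S x) = (\<Sum>e\<in>E. (x \<bullet> e) *\<^sub>R e)"
      unfolding Tx[OF Sx] by (intro sum.cong refl) (simp add: Se m0)
    then show "T (S x) = x" using orthonormal_expansion[OF E(1,2)] x E(3) by simp
  qed
qed

text \<open>Again a witness has to be exhibited before the \<open>SOME\<close> term can be used: the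
  adjoint applied to \<open>y\<close> has the coefficients \<open>T b \<bullet> y\<close>.\<close>

lemma adjoint_on_span:
  assumes B: "finite B" "orthonormal_set B" and T: "linear_on (span B) T"
    and x: "x \<in> span B" and y: "y \<in> span B"
  shows "T x \<bullet> y = x \<bullet> adjoint_on (span B) T y"
proof -
  let ?P = "\<lambda>T'. T' ` span B \<subseteq> span B \<and> (\<forall>x\<in>span B. \<forall>y\<in>span B. T x \<bullet> y = x \<bullet> T' y)"
  have "?P (\<lambda>y. \<Sum>b\<in>B. (T b \<bullet> y) *\<^sub>R b)"
    using linear_on_span_eq_sum[OF B T]
    by (auto intro!: linear_combination_in_span simp: inner_sum_left inner_sum_right mult_ac)
  then have "?P (adjoint_on (span B) T)"
    unfolding adjoint_on_def by (rule someI[of ?P])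
  with x y show ?thesis by blast
qed

lemma orth_proj_span:
  assumes B: "finite B" "orthonormal_set B"
  shows "orth_proj (span B) x = (\<Sum>b\<in>B. (x \<bullet> b) *\<^sub>R b)"
  unfolding orth_proj_def
proof (rule the_equality)
  let ?p = "\<Sum>b\<in>B. (x \<bullet> b) *\<^sub>R b"
  have p: "?p \<in> span B" by (rule linear_combination_in_span)
  have "orthogonal (x - ?p) y" if "y \<in> span B" for y
  proof (rule orthogonal_to_span[OF that])
    fix b assume "b \<in> B"
    then show "orthogonal (x - ?p) b"
      using inner_sum_orthonormal[OF B] by (simp add: orthogonal_def inner_diff_left)
  qed
  then show "?p \<in> span B \<and> x - ?p \<in> (span B)\<^sup>\<bottom>"
    using p by (auto simp: orthogonal_comp_def orthogonal_commute)
  fix y assume y: "y \<in> span B \<and> x - y \<in> (span B)\<^sup>\<bottom>"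
  have "y \<bullet> b = x \<bullet> b" if "b \<in> B" for b
    using y that span_base[OF that] by (auto simp: orthogonal_comp_def orthogonal_def inner_diff_right inner_commute)
  then have "(\<Sum>b\<in>B. (y \<bullet> b) *\<^sub>R b) = ?p" by (intro sum.cong) auto
  then show "y = ?p" using orthonormal_expansion[OF B] y by simp
qed

text \<open>The bound by \<open>K\<close> is what makes the supremum in \<open>opnorm_on\<close>
  meaningful: a real \<open>SUP\<close> over an unbounded set carries no information. Its size does
  not enter the conclusion.\<close>

lemma opnorm_on_bound:
  fixes T :: "'a::real_normed_vector \<Rightarrow> 'b::real_normed_vector"
  assumes V: "subspace V" and T: "linear_on V T" and K: "\<And>x. x \<in> V \<Longrightarrow> norm (T x) \<le> K * norm x"
    and x: "x \<in> V"
  shows "norm (T x) \<le> opnorm_on V T * norm x"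
proof (cases "x = 0")
  case False
  let ?u = "(1 / norm x) *\<^sub>R x"
  have "norm (T y) \<le> \<bar>K\<bar>" if "y \<in> V" "norm y \<le> 1" for y
  proof -
    have "norm (T y) \<le> \<bar>K\<bar> * norm y"
      by (rule order_trans[OF K[OF that(1)]]) (simp add: mult_right_mono)
    also have "\<dots> \<le> \<bar>K\<bar>" using that mult_left_mono[of "norm y" 1 "\<bar>K\<bar>"] by simp
    finally show ?thesis .
  qed
  then have "bdd_above ((\<lambda>x. norm (T x)) ` {x \<in> V. norm x \<le> 1})"
    by (intro bdd_aboveI[of _ "\<bar>K\<bar>"]) auto
  moreover have "?u \<in> {x \<in> V. norm x \<le> 1}" using V x False by (auto intro: subspace_scale)
  ultimately have "norm (T ?u) \<le> opnorm_on V T"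
    unfolding opnorm_on_def by (rule cSUP_upper2[rotated -1, OF order_refl])
  moreover have "T ?u = (1 / norm x) *\<^sub>R T x" using T x by (simp add: linear_on_def)
  ultimately show ?thesis using False by (simp add: field_simps)
qed (use linear_on_0[OF T V] in simp)

section \<open>Expansion in the eigenbasis\<close>

lemma continuous_on_atLeastI:
  fixes f :: "real \<Rightarrow> 'b::metric_space"
  assumes "\<And>b. continuous_on {a..b} f"
  shows "continuous_on {a..} f"
  unfolding continuous_on_iff
proof (intro ballI allI impI)
  fix x e :: real assume x: "x \<in> {a..}" and e: "0 < e"
  obtain d where d: "d > 0" "\<And>y. y \<in> {a..x+1} \<Longrightarrow> dist y x < d \<Longrightarrow> dist (f y) (f x) < e"
    using assms[of "x + 1"] x e unfolding continuous_on_iff by (metis atLeastAtMost_iff atLeast_iff less_add_one less_imp_le)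
  show "\<exists>d>0. \<forall>y\<in>{a..}. dist y x < d \<longrightarrow> dist (f y) (f x) < e"
    using d by (intro exI[of _ "min d 1"]) (auto simp: dist_real_def)
qed

locale orthonormal_basis_nat =
  fixes \<phi> :: "nat \<Rightarrow> 'a::{real_inner, banach, second_countable_topology}"
  assumes orthonormal: "j \<ge> 1 \<Longrightarrow> k \<ge> 1 \<Longrightarrow> \<phi> j \<bullet> \<phi> k = (if j = k then 1 else 0)"
    and total: "closure (span (\<phi> ` {1..})) = UNIV"
begin

lemma inj_on_basis: "inj_on \<phi> {1..}"
  by (rule inj_onI) (metis atLeast_iff orthonormal zero_neq_one)

lemma orthonormal_set_image: "orthonormal_set (\<phi> ` {1..n})"
  unfolding orthonormal_set_def using orthonormal inj_on_basis by (auto simp: inj_on_def)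

lemma subspace_Xc [simp]: "subspace (Xc \<phi> n)"
  by (simp add: Xc_def)

lemma Xc_mono: "m \<le> n \<Longrightarrow> Xc \<phi> m \<subseteq> Xc \<phi> n"
  unfolding Xc_def by (intro span_mono image_mono) auto

lemma basis_in_Xc: "j \<in> {1..n} \<Longrightarrow> \<phi> j \<in> Xc \<phi> n"
  by (simp add: Xc_def span_base)

lemma PN_eq_sum: "PN \<phi> n x = (\<Sum>j=1..n. (x \<bullet> \<phi> j) *\<^sub>R \<phi> j)"
proof -
  have "inj_on \<phi> {1..n}" by (rule inj_on_subset[OF inj_on_basis]) auto
  then show ?thesis
    unfolding PN_def Xc_def orth_proj_span[OF finite_imageI[OF finite_atLeastAtMost] orthonormal_set_image]
    by (simp add: sum.reindex)
qed

lemma bounded_linear_PN: "bounded_linear (PN \<phi> n)"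
  unfolding PN_eq_sum[abs_def] by (rule bounded_linear_finite_sum)

lemma PN_add: "PN \<phi> n (x + y) = PN \<phi> n x + PN \<phi> n y"
  and PN_diff: "PN \<phi> n (x - y) = PN \<phi> n x - PN \<phi> n y"
  and PN_minus: "PN \<phi> n (- x) = - PN \<phi> n x"
  and PN_scaleR: "PN \<phi> n (c *\<^sub>R x) = c *\<^sub>R PN \<phi> n x"
  using bounded_linear.linear[OF bounded_linear_PN]
  by (auto simp: linear_add linear_diff linear_neg linear_scale)

lemma PN_in_Xc: "PN \<phi> n x \<in> Xc \<phi> n"
  unfolding PN_eq_sum Xc_def by (intro span_sum span_scale span_base) auto

lemma PN_inner_basis:
  assumes "j \<ge> 1"
  shows "PN \<phi> n x \<bullet> \<phi> j = (if j \<le> n then x \<bullet> \<phi> j else 0)"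
proof -
  have "PN \<phi> n x \<bullet> \<phi> j = (\<Sum>k=1..n. if k = j then x \<bullet> \<phi> k else 0)"
    unfolding PN_eq_sum inner_sum_left using assms by (intro sum.cong) (auto simp: orthonormal)
  then show ?thesis using assms by simp
qed

lemma PN_symmetric: "PN \<phi> n x \<bullet> y = x \<bullet> PN \<phi> n y"
  unfolding PN_eq_sum inner_sum_left inner_sum_right
  by (intro sum.cong) (simp_all add: inner_commute)

lemma PN_PN_min: "PN \<phi> m (PN \<phi> n x) = PN \<phi> (min m n) x"
proof -
  have "PN \<phi> m (PN \<phi> n x) = (\<Sum>j=1..m. if j \<le> n then (x \<bullet> \<phi> j) *\<^sub>R \<phi> j else 0)"
    unfolding PN_eq_sum[of m] by (intro sum.cong) (auto simp: PN_inner_basis)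
  also have "\<dots> = (\<Sum>j\<in>{j\<in>{1..m}. j \<le> n}. (x \<bullet> \<phi> j) *\<^sub>R \<phi> j)"
    by (rule sum.inter_filter[symmetric]) simp
  also have "{j\<in>{1..m}. j \<le> n} = {1..min m n}" by auto
  finally show ?thesis by (simp add: PN_eq_sum)
qed

lemma PN_ident: "x \<in> Xc \<phi> n \<Longrightarrow> PN \<phi> n x = x"
  unfolding PN_def Xc_def orth_proj_span[OF finite_imageI[OF finite_atLeastAtMost] orthonormal_set_image]
  by (rule orthonormal_expansion[OF finite_imageI[OF finite_atLeastAtMost] orthonormal_set_image])

lemma PN_eq_0_Xs:
  assumes "x \<in> Xs \<phi> n"
  shows "PN \<phi> n x = 0"
  using assms basis_in_Xc[of _ n] unfolding PN_eq_sum
  by (intro sum.neutral) (auto simp: Xs_def orthogonal_comp_def orthogonal_def inner_commute)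

lemma norm_PN_Pythagoras: "(norm x)\<^sup>2 = (norm (PN \<phi> n x))\<^sup>2 + (norm (x - PN \<phi> n x))\<^sup>2"
proof -
  have "PN \<phi> n x \<bullet> (x - PN \<phi> n x) = 0"
    by (simp add: PN_symmetric PN_diff PN_PN_min)
  then show ?thesis
    by (simp add: power2_norm_eq_inner inner_diff_left inner_diff_right inner_commute)
qed

lemma norm_PN_le: "norm (PN \<phi> n x) \<le> norm x"
  and norm_diff_PN_le: "norm (x - PN \<phi> n x) \<le> norm x"
  using norm_PN_Pythagoras[of x n] by (auto intro: power2_le_imp_le)

lemma diff_PN_in_Xs: "x - PN \<phi> n x \<in> Xs \<phi> n"
proof -
  have "y \<bullet> (x - PN \<phi> n x) = 0" if "y \<in> Xc \<phi> n" for y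
  proof -
    have "y \<bullet> (x - PN \<phi> n x) = PN \<phi> n y \<bullet> (x - PN \<phi> n x)" using that by (simp add: PN_ident)
    then show ?thesis by (simp add: PN_symmetric PN_diff PN_PN_min)
  qed
  then show ?thesis by (simp add: Xs_def orthogonal_comp_def orthogonal_def)
qed

text \<open>Density suffices because the complementary projections are contractive. An approximating
  \<open>y\<close> lies in some \<open>Xc \<phi> m\<close> and is fixed by all later projections, so
  the error at \<open>x\<close> is that of \<open>x - y\<close>.\<close>

lemma PN_tendsto: "(\<lambda>n. PN \<phi> n x) \<longlonglongrightarrow> x"
proof (rule LIMSEQ_I)
  fix e :: real assume e: "0 < e"
  then obtain y where y: "y \<in> span (\<phi> ` {1..})" "dist y x < e"
    using total closure_approachable[of x "span (\<phi> ` {1..})"] by blast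
  have "subspace (\<Union>m. Xc \<phi> m)"
  proof (rule subspaceI)
    fix u w assume "u \<in> (\<Union>m. Xc \<phi> m)" "w \<in> (\<Union>m. Xc \<phi> m)"
    then obtain k l where "u \<in> Xc \<phi> k" "w \<in> Xc \<phi> l" by blast
    then have "u \<in> Xc \<phi> (max k l)" "w \<in> Xc \<phi> (max k l)"
      using Xc_mono[of k "max k l"] Xc_mono[of l "max k l"] by auto
    then show "u + w \<in> (\<Union>m. Xc \<phi> m)" using subspace_add[OF subspace_Xc] by blast
  qed (use subspace_0[OF subspace_Xc] subspace_scale[OF subspace_Xc] in blast)+
  moreover have "\<phi> ` {1..} \<subseteq> (\<Union>m. Xc \<phi> m)"
    using basis_in_Xc by fastforce
  ultimately obtain m where m: "y \<in> Xc \<phi> m"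
    using span_minimal y(1) by blast
  have "norm (PN \<phi> n x - x) < e" if "n \<ge> m" for n
  proof -
    have "PN \<phi> n y = y" using m Xc_mono[OF that] by (intro PN_ident) auto
    then have "norm (PN \<phi> n x - x) = norm ((x - y) - PN \<phi> n (x - y))"
      by (simp add: PN_diff norm_minus_commute)
    also have "\<dots> \<le> norm (x - y)" by (rule norm_diff_PN_le)
    also have "\<dots> < e" using y(2) by (simp add: dist_norm norm_minus_commute)
    finally show ?thesis .
  qed
  then show "\<exists>no. \<forall>n\<ge>no. norm (PN \<phi> n x - x) < e" by blast
qed

lemma norm_sum_basis:
  assumes "finite I" "\<And>i. i \<in> I \<Longrightarrow> i \<ge> 1"
  shows "(norm (\<Sum>i\<in>I. c i *\<^sub>R \<phi> i))\<^sup>2 = (\<Sum>i\<in>I. (c i)\<^sup>2)"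
proof -
  have "(norm (\<Sum>i\<in>I. c i *\<^sub>R \<phi> i))\<^sup>2 = (\<Sum>i\<in>I. \<Sum>j\<in>I. if i = j then (c i)\<^sup>2 else 0)"
    unfolding power2_norm_eq_inner inner_sum_left inner_sum_right using assms(2)
    by (intro sum.cong) (auto simp: orthonormal power2_eq_square)
  then show ?thesis using assms(1) by simp
qed

lemma summable_inner_basis_squared: "summable (\<lambda>j. (x \<bullet> \<phi> (Suc j))\<^sup>2)"
proof (rule summableI_nonneg_bounded)
  fix n
  have "(\<Sum>j<n. (x \<bullet> \<phi> (Suc j))\<^sup>2) = (\<Sum>j=1..n. (x \<bullet> \<phi> j)\<^sup>2)"
    by (rule sum.reindex_bij_witness[of _ "\<lambda>j. j - 1" Suc]) auto
  also have "\<dots> = (norm (PN \<phi> n x))\<^sup>2"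
    unfolding PN_eq_sum by (rule norm_sum_basis[symmetric]) auto
  also have "\<dots> \<le> (norm x)\<^sup>2" by (simp add: norm_PN_le)
  finally show "(\<Sum>j<n. (x \<bullet> \<phi> (Suc j))\<^sup>2) \<le> (norm x)\<^sup>2" .
qed simp

text \<open>\<open>heat_semigroup\<close> is the case
  \<open>c j = exp (- ev (Suc j) * \<tau>)\<close>. A \<open>suminf\<close> is usable only after
  summability is shown; since the multipliers are at most 1 in modulus, its Cauchy blocks are
  controlled by Bessel's inequality, which also yields contractivity. The index \<open>k - 1\<close>
  arises because the series starts at 0 and the basis at 1.\<close>

lemma
  assumes c: "\<And>j. \<bar>c j\<bar> \<le> (1::real)"
  shows inner_diagonal: "k \<ge> 1 \<Longrightarrow> (\<Sum>j. (c j * (x \<bullet> \<phi> (Suc j))) *\<^sub>R \<phi> (Suc j)) \<bullet> \<phi> k = c (k - 1) * (x \<bullet> \<phi> k)"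
    and norm_diagonal_le: "norm (\<Sum>j. (c j * (x \<bullet> \<phi> (Suc j))) *\<^sub>R \<phi> (Suc j)) \<le> norm x"
proof -
  let ?f = "\<lambda>j. (c j * (x \<bullet> \<phi> (Suc j))) *\<^sub>R \<phi> (Suc j)"
  have ns: "(norm (\<Sum>j=m..<n. ?f j))\<^sup>2 \<le> (\<Sum>j=m..<n. (x \<bullet> \<phi> (Suc j))\<^sup>2)" for m n
  proof -
    have "(\<Sum>j=m..<n. ?f j) = (\<Sum>j\<in>{Suc m..<Suc n}. (c (j - 1) * (x \<bullet> \<phi> j)) *\<^sub>R \<phi> j)"
      by (rule sum.reindex_bij_witness[of _ "\<lambda>j. j - 1" Suc]) auto
    also have "(norm \<dots>)\<^sup>2 = (\<Sum>j\<in>{Suc m..<Suc n}. (c (j - 1) * (x \<bullet> \<phi> j))\<^sup>2)"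
      by (rule norm_sum_basis) auto
    also have "\<dots> = (\<Sum>j=m..<n. (c j * (x \<bullet> \<phi> (Suc j)))\<^sup>2)"
      by (rule sum.reindex_bij_witness[of _ Suc "\<lambda>j. j - 1"]) auto
    also have "\<dots> \<le> (\<Sum>j=m..<n. (x \<bullet> \<phi> (Suc j))\<^sup>2)"
      using c by (intro sum_mono) (auto simp: power_mult_distrib abs_square_le_1 intro!: mult_left_le_one_le)
    finally show ?thesis .
  qed
  have sm: "summable ?f"
    unfolding summable_Cauchy
  proof (intro allI impI)
    fix e :: real assume "0 < e"
    then obtain N where N: "\<And>m n. m \<ge> N \<Longrightarrow> norm (\<Sum>j=m..<n. (x \<bullet> \<phi> (Suc j))\<^sup>2) < e\<^sup>2"
      using summable_inner_basis_squared[of x] unfolding summable_Cauchy by (metis zero_less_power)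
    have "norm (\<Sum>j=m..<n. ?f j) < e" if "m \<ge> N" for m n
    proof (rule power2_less_imp_less)
      show "(norm (\<Sum>j=m..<n. ?f j))\<^sup>2 < e\<^sup>2"
        using ns[of m n] N[OF that, of n] by simp
    qed (use \<open>0 < e\<close> in simp)
    then show "\<exists>N. \<forall>m\<ge>N. \<forall>n. norm (\<Sum>j=m..<n. ?f j) < e" by blast
  qed
  show "norm (\<Sum>j. ?f j) \<le> norm x"
  proof (rule LIMSEQ_le_const2)
    show "(\<lambda>n. norm (\<Sum>j<n. ?f j)) \<longlonglongrightarrow> norm (\<Sum>j. ?f j)"
      by (intro tendsto_norm summable_LIMSEQ sm)
    have "(norm (\<Sum>j<n. ?f j))\<^sup>2 \<le> (norm x)\<^sup>2" for n
    proof -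
      have "(\<Sum>j=0..<n. (x \<bullet> \<phi> (Suc j))\<^sup>2) = (\<Sum>j=1..n. (x \<bullet> \<phi> j)\<^sup>2)"
        by (rule sum.reindex_bij_witness[of _ "\<lambda>j. j - 1" Suc]) auto
      also have "\<dots> = (norm (PN \<phi> n x))\<^sup>2"
        unfolding PN_eq_sum by (rule norm_sum_basis[symmetric]) auto
      also have "\<dots> \<le> (norm x)\<^sup>2" by (simp add: norm_PN_le)
      finally show ?thesis using ns[of 0 n] unfolding atLeast0LessThan by linarith
    qed
    then show "\<exists>N. \<forall>n\<ge>N. norm (\<Sum>j<n. ?f j) \<le> norm x"
      by (meson norm_ge_zero power2_le_imp_le)
  qed
  assume k: "k \<ge> 1"
  have "(\<Sum>j. ?f j) \<bullet> \<phi> k = (\<Sum>j. ?f j \<bullet> \<phi> k)"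
    using bounded_linear.suminf[OF bounded_linear_inner_left sm] .
  also have "\<dots> = (\<Sum>j\<in>{k - 1}. ?f j \<bullet> \<phi> k)"
    using k by (intro suminf_finite) (auto simp: orthonormal)
  also have "\<dots> = c (k - 1) * (x \<bullet> \<phi> k)"
    using k by (simp add: orthonormal)
  finally show "(\<Sum>j. ?f j) \<bullet> \<phi> k = c (k - 1) * (x \<bullet> \<phi> k)" .
qed

end

section \<open>Weak form of the evolution equation\<close>

lemma admissible_set_integrable:
  assumes d: "admissible dmin dmax d" and "0 \<le> a"
  shows "set_integrable lebesgue {a..b} d"
proof -
  have "set_integrable lebesgue {a..b} (\<lambda>_. max \<bar>dmin\<bar> \<bar>dmax\<bar>)"
    by (rule set_integrable_lebesgue_continuous) simp
  then show ?thesis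
  proof (rule set_integrable_bound)
    have "(\<lambda>r. indicator {0..} r *\<^sub>R d r) \<in> borel_measurable lebesgue"
      using d by (simp add: admissible_def borel_measurable_restrict_space_iff)
    then have "(\<lambda>r. indicator {a..b} r *\<^sub>R (indicator {0..} r *\<^sub>R d r)) \<in> borel_measurable lebesgue"
      by (rule borel_measurable_scaleR[OF borel_measurable_indicator, rotated]) simp
    moreover have "(\<lambda>r. indicator {a..b} r *\<^sub>R (indicator {0..} r *\<^sub>R d r)) = (\<lambda>r. indicator {a..b} r *\<^sub>R d r)"
      using \<open>0 \<le> a\<close> by (auto simp: indicator_def)
    ultimately show "set_borel_measurable lebesgue {a..b} d"
      by (simp add: set_borel_measurable_def)
    have "\<bar>d r\<bar> \<le> max \<bar>dmin\<bar> \<bar>dmax\<bar>" if "r \<ge> 0" for r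
      using d that by (auto simp: admissible_def)
    then show "AE r in lebesgue. r \<in> {a..b} \<longrightarrow> norm (d r) \<le> norm (max \<bar>dmin\<bar> \<bar>dmax\<bar>)"
      using \<open>0 \<le> a\<close> by (intro AE_I2) auto
  qed
qed

text \<open>Testing against an eigenvector moves \<open>A0\<close> onto it, so no value of
  \<open>z\<close> has to lie in the domain and each coordinate solves a scalar equation. Strong and
  mild solutions share this form.\<close>

definition weak_solution ::
    "(nat \<Rightarrow> 'a) \<Rightarrow> (nat \<Rightarrow> real) \<Rightarrow> ('a \<Rightarrow>\<^sub>L 'a) \<Rightarrow> (real \<Rightarrow> real) \<Rightarrow> real \<Rightarrow>
     (real \<Rightarrow> 'a::{real_inner, banach, second_countable_topology}) \<Rightarrow> bool" where
  "weak_solution \<phi> ev L d s0 z \<longleftrightarrow>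
     continuous_on {s0..} z \<and>
     (\<forall>j\<ge>1. \<forall>t\<ge>s0. z t \<bullet> \<phi> j = z s0 \<bullet> \<phi> j
        + (LINT r:{s0..t}|lebesgue. - (d r * (ev j * (z r \<bullet> \<phi> j))) - L (z r) \<bullet> \<phi> j))"

lemma set_integrable_mult_continuous:
  fixes d h :: "real \<Rightarrow> real"
  assumes "set_integrable lebesgue {a..b} d" "continuous_on {a..b} h"
  shows "set_integrable lebesgue {a..b} (\<lambda>r. d r * h r)"
  using set_integrable_inner_continuous[OF assms] by (simp add: mult.commute)

lemma set_integrable_weak_rhs:
  fixes z :: "real \<Rightarrow> 'a::{real_inner, banach, second_countable_topology}"
  assumes d: "set_integrable lebesgue {a..b} d" and z: "continuous_on {a..b} z"
  shows "set_integrable lebesgue {a..b} (\<lambda>r. - (d r * (c * (z r \<bullet> p))) - blinfun_apply L (z r) \<bullet> p)"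
proof -
  have "set_integrable lebesgue {a..b} (\<lambda>r. d r * (- (c * (z r \<bullet> p))))"
    using d by (rule set_integrable_mult_continuous) (intro continuous_intros z)
  moreover have "set_integrable lebesgue {a..b} (\<lambda>r. blinfun_apply L (z r) \<bullet> p)"
    by (intro set_integrable_lebesgue_continuous continuous_intros z)
  ultimately have "set_integrable lebesgue {a..b}
      (\<lambda>r. d r * (- (c * (z r \<bullet> p))) - blinfun_apply L (z r) \<bullet> p)"
    by (rule set_integral_diff)
  then show ?thesis by simp
qed

text \<open>Pair the almost everywhere equation with \<open>\<phi> j\<close> and move
  \<open>A0\<close> across by symmetry; integration forgets the exceptional null set.\<close>

lemma strong_solution_imp_weak:
  assumes d: "admissible dmin dmax d" and "0 \<le> s0"
    and sym: "\<And>x y. x \<in> D \<Longrightarrow> y \<in> D \<Longrightarrow> A0 x \<bullet> y = x \<bullet> A0 y"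
    and eig: "\<And>j. j \<ge> 1 \<Longrightarrow> \<phi> j \<in> D \<and> A0 (\<phi> j) = ev j *\<^sub>R \<phi> j"
    and z: "strong_solution D A0 L d s0 z"
  shows "weak_solution \<phi> ev L d s0 z"
proof -
  obtain v where v: "\<forall>t\<ge>s0. set_integrable lebesgue {s0..t} v \<and> z t = z s0 + (LINT r:{s0..t}|lebesgue. v r)"
    and ae: "AE r in lebesgue. s0 \<le> r \<longrightarrow> z r \<in> D \<and> v r + d r *\<^sub>R A0 (z r) + L (z r) = 0"
    using z unfolding strong_solution_def by (elim exE conjE) (rule that)
  have vi: "\<And>t. t \<ge> s0 \<Longrightarrow> set_integrable lebesgue {s0..t} v"
    and zv: "\<And>t. t \<ge> s0 \<Longrightarrow> z t = z s0 + (LINT r:{s0..t}|lebesgue. v r)"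
    using v by blast+
  have cont: "continuous_on {s0..b} z" for b
  proof (cases "s0 \<le> b")
    case True
    then show ?thesis
      by (intro continuous_on_indefinite_integral[OF vi[OF True]] zv) simp
  qed simp
  have "z t \<bullet> \<phi> j = z s0 \<bullet> \<phi> j
        + (LINT r:{s0..t}|lebesgue. - (d r * (ev j * (z r \<bullet> \<phi> j))) - L (z r) \<bullet> \<phi> j)"
    if j: "j \<ge> 1" and t: "t \<ge> s0" for j t
  proof -
    have "z t \<bullet> \<phi> j = z s0 \<bullet> \<phi> j + (LINT r:{s0..t}|lebesgue. \<phi> j \<bullet> v r)"
      unfolding set_integral_inner_left[OF vi[OF t]] using zv[OF t]
      by (simp add: inner_add_left inner_commute[of "\<phi> j"])
    also have "(LINT r:{s0..t}|lebesgue. \<phi> j \<bullet> v r)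
        = (LINT r:{s0..t}|lebesgue. - (d r * (ev j * (z r \<bullet> \<phi> j))) - L (z r) \<bullet> \<phi> j)"
      unfolding set_lebesgue_integral_def
    proof (rule integral_cong_AE)
      have "set_integrable lebesgue {s0..t} (\<lambda>r. \<phi> j \<bullet> v r)"
        using vi[OF t] by (rule set_integrable_inner_continuous) simp
      then show "(\<lambda>r. indicator {s0..t} r *\<^sub>R (\<phi> j \<bullet> v r)) \<in> borel_measurable lebesgue"
        unfolding set_integrable_def by (rule borel_measurable_integrable)
      have "set_integrable lebesgue {s0..t} (\<lambda>r. - (d r * (ev j * (z r \<bullet> \<phi> j))) - L (z r) \<bullet> \<phi> j)"
        by (intro set_integrable_weak_rhs admissible_set_integrable[OF d] cont \<open>0 \<le> s0\<close>)
      then show "(\<lambda>r. indicator {s0..t} r *\<^sub>R (- (d r * (ev j * (z r \<bullet> \<phi> j))) - L (z r) \<bullet> \<phi> j))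
          \<in> borel_measurable lebesgue"
        unfolding set_integrable_def by (rule borel_measurable_integrable)
      show "AE r in lebesgue. indicator {s0..t} r *\<^sub>R (\<phi> j \<bullet> v r)
          = indicator {s0..t} r *\<^sub>R (- (d r * (ev j * (z r \<bullet> \<phi> j))) - L (z r) \<bullet> \<phi> j)"
        using ae
      proof eventually_elim
        case (elim r)
        show ?case
        proof (cases "r \<in> {s0..t}")
          case True
          then have zr: "z r \<in> D" and v: "v r + d r *\<^sub>R A0 (z r) + L (z r) = 0" using elim by auto
          have "v r = (v r + d r *\<^sub>R A0 (z r) + L (z r)) - d r *\<^sub>R A0 (z r) - L (z r)" by simp
          also have "\<dots> = - (d r *\<^sub>R A0 (z r)) - L (z r)" unfolding v by simp
          finally have "v r = - (d r *\<^sub>R A0 (z r)) - L (z r)" .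
          moreover have "A0 (z r) \<bullet> \<phi> j = ev j * (z r \<bullet> \<phi> j)"
            using sym[OF zr, of "\<phi> j"] eig[OF j] by simp
          ultimately have "\<phi> j \<bullet> v r = - (d r * (ev j * (z r \<bullet> \<phi> j))) - L (z r) \<bullet> \<phi> j"
            by (simp add: inner_commute[of "\<phi> j"] inner_diff_left)
          then show ?thesis by simp
        qed simp
      qed
    qed
    finally show ?thesis .
  qed
  then show ?thesis
    unfolding weak_solution_def using continuous_on_atLeastI[OF cont] by blast
qed

text \<open>In coordinate \<open>j\<close> the variation of constants formula is a scalar one with
  the integrating factor \<open>exp (ev j * DD t)\<close>, where \<open>DD\<close> is the primitive
  of \<open>d\<close>. Undoing it requires a product rule for factors that are only absolutely
  continuous, because \<open>d\<close> is only measurable.\<close>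

lemma mild_solution_imp_weak:
  assumes "orthonormal_basis_nat \<phi>" and ev: "\<And>j. j \<ge> 1 \<Longrightarrow> 0 < ev j"
    and d: "admissible dmin dmax d" and "0 \<le> dmin" and "0 \<le> s0"
    and z: "mild_solution \<phi> ev L d s0 z"
  shows "weak_solution \<phi> ev L d s0 z"
proof -
  interpret orthonormal_basis_nat \<phi> by fact
  have zc: "continuous_on {s0..} z"
    and zm: "\<And>t. t \<ge> s0 \<Longrightarrow> z t = free_evol \<phi> ev d t s0 (z s0)
                    - (LINT r:{s0..t}|lebesgue. free_evol \<phi> ev d t r (L (z r)))"
    using z unfolding mild_solution_def by blast+
  have zc': "continuous_on {a..b} z" if "s0 \<le> a" for a b
    using that by (auto intro: continuous_on_subset[OF zc])
  have di: "set_integrable lebesgue {a..b} d" if "s0 \<le> a" for a b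
    using that \<open>0 \<le> s0\<close> by (intro admissible_set_integrable[OF d]) auto
  have d0: "0 \<le> (LINT r:{a..b}|lebesgue. d r)" if "s0 \<le> a" for a b
    unfolding set_lebesgue_integral_def
    using d that \<open>0 \<le> s0\<close> \<open>0 \<le> dmin\<close>
    by (intro integral_nonneg_AE AE_I2) (auto simp: admissible_def indicator_def intro: order_trans)
  have contr: "\<bar>exp (- ev (Suc i) * (LINT r:{a..b}|lebesgue. d r))\<bar> \<le> 1" if "s0 \<le> a" for i a b
    using d0[OF that] ev[of "Suc i"] by simp
  define DD where "DD t = (LINT r:{s0..t}|lebesgue. d r)" for t
  have DDc: "continuous_on {s0..b} DD" for b
    by (rule continuous_on_indefinite_integral[OF di]) (auto simp: DD_def)
  have DDd: "(LINT r:{r..t}|lebesgue. d r) = DD t - DD r" if "s0 \<le> r" "r \<le> t" for r t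
    unfolding DD_def using set_integral_Icc_split[OF di that] by simp
  have fe: "free_evol \<phi> ev d t r x \<bullet> \<phi> j = exp (- ev j * (DD t - DD r)) * (x \<bullet> \<phi> j)"
    if "s0 \<le> r" "r \<le> t" "j \<ge> 1" for t r x j
    unfolding free_evol_def heat_semigroup_def
    using that by (subst inner_diagonal[OF contr]) (simp_all add: DDd)
  \<comment> \<open>This allows the inner product with \<open>\<phi> j\<close> to be moved inside
    the Bochner integral. Measurability in \<open>r\<close> comes from the series: every term is
    continuous on the interval. The size is controlled by contractivity.\<close>
  have qi: "set_integrable lebesgue {s0..t} (\<lambda>r. free_evol \<phi> ev d t r (L (z r)))" for t
  proof -
    have "set_integrable lebesgue {s0..t} (\<lambda>r. L (z r))"
      by (intro set_integrable_lebesgue_continuous continuous_intros zc') simp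
    then show ?thesis
    proof (rule set_integrable_bound)
      have "norm (free_evol \<phi> ev d t r (L (z r))) \<le> norm (L (z r))" if "s0 \<le> r" for r
        unfolding free_evol_def heat_semigroup_def by (rule norm_diagonal_le[OF contr[OF that]])
      then show "AE r in lebesgue. r \<in> {s0..t} \<longrightarrow> norm (free_evol \<phi> ev d t r (L (z r))) \<le> norm (L (z r))"
        by (intro AE_I2) auto
      define f where "f j r = (exp (- ev (Suc j) * (DD t - DD r)) * (L (z r) \<bullet> \<phi> (Suc j))) *\<^sub>R \<phi> (Suc j)" for j r
      have "(\<lambda>r. \<Sum>j. indicator {s0..t} r *\<^sub>R f j r) \<in> borel_measurable lebesgue"
      proof (rule borel_measurable_suminf)
        fix j
        have "continuous_on {s0..t} (f j)"
          unfolding f_def by (intro continuous_intros DDc zc') simp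
        then show "(\<lambda>r. indicator {s0..t} r *\<^sub>R f j r) \<in> borel_measurable lebesgue"
          using set_borel_measurable_lebesgue_continuous by (simp add: set_borel_measurable_def)
      qed
      moreover have "(\<Sum>j. indicator {s0..t} r *\<^sub>R f j r) = indicator {s0..t} r *\<^sub>R free_evol \<phi> ev d t r (L (z r))" for r
        by (cases "r \<in> {s0..t}") (auto simp: f_def free_evol_def heat_semigroup_def DDd)
      ultimately show "set_borel_measurable lebesgue {s0..t} (\<lambda>r. free_evol \<phi> ev d t r (L (z r)))"
        by (simp add: set_borel_measurable_def)
    qed
  qed
  have "z t \<bullet> \<phi> j = z s0 \<bullet> \<phi> j
        + (LINT r:{s0..t}|lebesgue. - (d r * (ev j * (z r \<bullet> \<phi> j))) - L (z r) \<bullet> \<phi> j)"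
    if j: "j \<ge> 1" and t: "t \<ge> s0" for j t
  proof -
    define p where "p r = L (z r) \<bullet> \<phi> j" for r
    \<comment> \<open>The coordinate multiplied by its integrating factor, as \<open>zy\<close>
      confirms. In contrast to the mild formula its integrand does not depend on the upper limit, so
      \<open>y\<close> is an indefinite integral.\<close>
    define y where "y t = z s0 \<bullet> \<phi> j + (LINT r:{s0..t}|lebesgue. - exp (ev j * DD r) * p r)" for t
    have ei: "set_integrable lebesgue {s0..b} (\<lambda>r. - exp (ev j * DD r) * p r)" for b
      unfolding p_def by (intro set_integrable_lebesgue_continuous continuous_intros DDc zc') simp
    have zy: "z u \<bullet> \<phi> j = exp (- ev j * DD u) * y u" if u: "s0 \<le> u" for u
    proof -
      have "z u \<bullet> \<phi> j = exp (- ev j * DD u) * (z s0 \<bullet> \<phi> j)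
          - (LINT r:{s0..u}|lebesgue. \<phi> j \<bullet> free_evol \<phi> ev d u r (L (z r)))"
        unfolding set_integral_inner_left[OF qi] using zm[OF u] fe[of s0 u j "z s0"] u j
        by (simp add: inner_diff_left inner_commute[of "\<phi> j"] DD_def)
      also have "(LINT r:{s0..u}|lebesgue. \<phi> j \<bullet> free_evol \<phi> ev d u r (L (z r)))
          = (LINT r:{s0..u}|lebesgue. - exp (- ev j * DD u) * (- exp (ev j * DD r) * p r))"
        using fe[OF _ _ j]
        by (intro set_lebesgue_integral_cong)
          (auto simp: inner_commute[of "\<phi> j"] p_def algebra_simps exp_diff exp_minus field_simps)
      also have "\<dots> = - exp (- ev j * DD u) * (LINT r:{s0..u}|lebesgue. - exp (ev j * DD r) * p r)"
        by (rule set_integral_mult_right)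
      finally show ?thesis by (simp add: y_def algebra_simps)
    qed
    \<comment> \<open>The product rule is obtained as the chain rule in the plane: \<open>F\<close>
      along the curve \<open>f\<close>, whose weak derivative is \<open>g\<close> and whose second
      component removes the integrating factor.\<close>
    define f where "f r = (DD r, y r)" for r
    define g where "g r = (d r, - exp (ev j * DD r) * p r)" for r
    define F where "F x = exp (- ev j * fst x) * snd x" for x :: "real \<times> real"
    define G where "G x = (- ev j * exp (- ev j * fst x) * snd x, exp (- ev j * fst x))" for x :: "real \<times> real"
    have g: "g = (\<lambda>r. d r *\<^sub>R (1, 0) + (- exp (ev j * DD r) * p r) *\<^sub>R (0, 1))"
      by (simp add: g_def fun_eq_iff)
    have gi: "set_integrable lebesgue {s0..b} g" for b
      unfolding g using di[of s0 b] ei[of b] by (intro set_integral_add(1) set_integrable_scaleR_left) auto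
    have fg: "f b = f s0 + (LINT r:{s0..b}|lebesgue. g r)" for b
    proof -
      have "(LINT r:{s0..b}|lebesgue. g r) = DD b *\<^sub>R (1, 0) + (y b - y s0) *\<^sub>R (0, 1)"
        unfolding g
        by (subst set_integral_add(2)[OF set_integrable_scaleR_left[OF di] set_integrable_scaleR_left[OF ei]])
          (simp_all only: set_integral_scaleR_vector[OF di] set_integral_scaleR_vector[OF ei] DD_def[of b] y_def
            order_refl set_integral_singleton atLeastAtMost_singleton add_0_right add_diff_cancel_left')
      then show ?thesis by (simp add: f_def) (simp add: DD_def)
    qed
    have "(F has_derivative (\<lambda>h. G x \<bullet> h)) (at x)" for x
      unfolding F_def G_def
      by (auto intro!: derivative_eq_intros simp: fun_eq_iff inner_prod_def algebra_simps)
    moreover have "continuous_on UNIV G"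
      unfolding G_def by (intro continuous_intros)
    ultimately have "F (f t) - F (f s0) = (LINT r:{s0..t}|lebesgue. G (f r) \<bullet> g r)"
      using chain_rule_indefinite_integral(2)[OF t gi, of f F G] fg by blast
    also have "\<dots> = (LINT r:{s0..t}|lebesgue. - (d r * (ev j * (z r \<bullet> \<phi> j))) - p r)"
      by (intro set_lebesgue_integral_cong)
        (auto simp: zy G_def f_def g_def inner_prod_def mult_ac exp_minus)
    finally show ?thesis
      using zy[OF t] zy[of s0] by (simp add: F_def f_def p_def)
  qed
  then show ?thesis unfolding weak_solution_def using zc by blast
qed

section \<open>The Lyapunov function\<close>

text \<open>A Gronwall argument without derivatives. \<open>V\<close> is nonincreasing, so on
  \<open>{u..w}\<close> it is at least \<open>V w\<close>, and the hypothesis becomes an implicit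
  Euler step \<open>(1 + c * (w - u)) * V w \<le> V u\<close>. Iterating over \<open>n\<close> equal
  steps and letting \<open>n\<close> grow turns the product into the exponential.\<close>

lemma exp_decay_of_integral_inequality:
  fixes V :: "real \<Rightarrow> real"
  assumes st: "s \<le> t" and c: "0 \<le> c" and V: "continuous_on {s..t} V" "\<And>r. 0 \<le> V r"
    and dec: "\<And>u w. s \<le> u \<Longrightarrow> u \<le> w \<Longrightarrow> w \<le> t \<Longrightarrow> V w \<le> V u - c * (LINT r:{u..w}|lebesgue. V r)"
  shows "V t \<le> exp (- c * (t - s)) * V s"
proof -
  have Vi: "set_integrable lebesgue {u..w} V" if "s \<le> u" "w \<le> t" for u w
    using that by (intro set_integrable_lebesgue_continuous continuous_on_subset[OF V(1)]) auto
  have mono: "V w \<le> V u" if "s \<le> u" "u \<le> w" "w \<le> t" for u w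
  proof -
    have "0 \<le> (LINT r:{u..w}|lebesgue. V r)"
      unfolding set_lebesgue_integral_def by (intro integral_nonneg_AE AE_I2) (simp add: V)
    then show ?thesis using dec[OF that] c mult_nonneg_nonneg[of c "LINT r:{u..w}|lebesgue. V r"] by linarith
  qed
  have step: "(1 + c * (w - u)) * V w \<le> V u" if "s \<le> u" "u \<le> w" "w \<le> t" for u w
  proof -
    have "(w - u) * V w = (LINT r:{u..w}|lebesgue. V w)"
      using set_integral_const_Icc[OF that(2)] by simp
    also have "\<dots> \<le> (LINT r:{u..w}|lebesgue. V r)"
      using that by (intro set_integral_mono Vi set_integrable_lebesgue_continuous mono) auto
    finally have "c * ((w - u) * V w) \<le> c * (LINT r:{u..w}|lebesgue. V r)"
      using c by (rule mult_left_mono)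
    then show ?thesis using dec[OF that] by (simp add: algebra_simps)
  qed
  have disc: "(1 + c * (t - s) / real n) ^ n * V t \<le> V s" if n: "n \<ge> 1" for n
  proof -
    define h where "h = (t - s) / real n"
    have h: "0 \<le> h" "real n * h = t - s" using st n by (auto simp: h_def)
    have "(1 + c * h) ^ k * V (s + real k * h) \<le> V s" if "k \<le> n" for k
      using that
    proof (induction k)
      case (Suc k)
      have kh: "real (Suc k) * h \<le> t - s"
        unfolding h(2)[symmetric] using h(1) Suc.prems by (intro mult_right_mono) auto
      have "(1 + c * h) * V (s + real (Suc k) * h) \<le> V (s + real k * h)"
        using step[of "s + real k * h" "s + real (Suc k) * h"] h(1) kh by (simp add: algebra_simps)
      then have "(1 + c * h) ^ k * ((1 + c * h) * V (s + real (Suc k) * h)) \<le> (1 + c * h) ^ k * V (s + real k * h)"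
        using c h(1) by (intro mult_left_mono) auto
      also have "\<dots> \<le> V s" using Suc by simp
      finally show ?case by (simp add: mult_ac)
    qed simp
    from this[of n] show ?thesis using h(2) by (simp add: h_def)
  qed
  have "exp (c * (t - s)) * V t \<le> V s"
  proof (rule LIMSEQ_le_const2)
    show "(\<lambda>n. (1 + c * (t - s) / real n) ^ n * V t) \<longlonglongrightarrow> exp (c * (t - s)) * V t"
      by (intro tendsto_mult tendsto_const tendsto_exp_limit_sequentially)
    show "\<exists>N. \<forall>n\<ge>N. (1 + c * (t - s) / real n) ^ n * V t \<le> V s"
      using disc by blast
  qed
  then have "exp (- (c * (t - s))) * (exp (c * (t - s)) * V t) \<le> exp (- (c * (t - s))) * V s"
    by (intro mult_left_mono) auto
  then show ?thesis by (simp add: mult.assoc[symmetric] exp_add[symmetric])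
qed

text \<open>The discriminant test; multiplying by \<open>4 * p\<close> completes the square without
  a division.\<close>

lemma binary_quadratic_form_nonneg:
  fixes p q g a b :: real
  assumes "0 < p" "g\<^sup>2 \<le> 4 * p * q"
  shows "0 \<le> p * a\<^sup>2 - g * a * b + q * b\<^sup>2"
proof -
  have "4 * p * (p * a\<^sup>2 - g * a * b + q * b\<^sup>2) = (2 * p * a - g * b)\<^sup>2 + (4 * p * q - g\<^sup>2) * b\<^sup>2"
    by (simp add: algebra_simps power2_eq_square)
  also have "\<dots> \<ge> 0" using assms by simp
  finally show ?thesis using assms(1) by (simp add: zero_le_mult_iff)
qed

text \<open>The trajectory is deliberately not a parameter here: constants obtained in this context
  cannot depend on it, which is the uniformity to be proved.\<close>

locale stabilized_system = orthonormal_basis_nat \<phi>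
  for \<phi> :: "nat \<Rightarrow> 'a::{real_inner, banach, second_countable_topology}" +
  fixes D :: "'a set" and A0 :: "'a \<Rightarrow> 'a" and ev :: "nat \<Rightarrow> real" and L :: "'a \<Rightarrow>\<^sub>L 'a"
    and N :: nat and Pc :: "'a \<Rightarrow> 'a" and dmin dmax \<mu>\<^sub>s \<mu>\<^sub>c \<eta> :: real
  assumes D_subspace: "subspace D" and A0_linear: "linear_on D A0"
    and eigen: "\<And>j. j \<ge> 1 \<Longrightarrow> \<phi> j \<in> D \<and> A0 (\<phi> j) = ev j *\<^sub>R \<phi> j"
    and ev_mono: "mono_on {1..} ev" and ev_pos: "0 < ev 1"
    and dmin_pos: "0 < dmin"
    and \<mu>\<^sub>s_def: "\<mu>\<^sub>s = dmin * ev (N + 1) - ell_s L \<phi> N" and \<mu>\<^sub>s_pos: "0 < \<mu>\<^sub>s"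
    and Pc_posdef: "selfadjoint_posdef_on (Xc \<phi> N) Pc" and \<mu>\<^sub>c_pos: "0 < \<mu>\<^sub>c"
    and lyapunov: "\<forall>d\<in>{dmin..dmax}.
           op_le_on (Xc \<phi> N)
             (\<lambda>x. Pc (Gcc A0 L \<phi> N d x) + adjoint_on (Xc \<phi> N) (Gcc A0 L \<phi> N d) (Pc x))
             (\<lambda>x. (- 2 * \<mu>\<^sub>c) *\<^sub>R Pc x)"
    and \<eta>_pos: "0 < \<eta>"
    and small_gain: "4 * \<eta> * \<mu>\<^sub>c * \<mu>\<^sub>s > (gamma_cs L \<phi> N Pc + \<eta> * gamma_sc L \<phi> N Pc)\<^sup>2"
begin

abbreviation "P \<equiv> PN \<phi> N"
abbreviation "R \<equiv> sqrt_on (Xc \<phi> N) Pc"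

section \<open>Eigenvalues and the square root of \<Pi>\<close>

lemma ev_ge: "1 \<le> j \<Longrightarrow> j \<le> k \<Longrightarrow> ev j \<le> ev k"
  using ev_mono by (auto simp: mono_on_def)

lemma ev_gt_0: "1 \<le> j \<Longrightarrow> 0 < ev j"
  using ev_ge[of 1 j] ev_pos by simp

lemma A0_PN: "A0 (PN \<phi> n x) = (\<Sum>j=1..n. (ev j * (x \<bullet> \<phi> j)) *\<^sub>R \<phi> j)"
proof -
  have "A0 (PN \<phi> n x) = (\<Sum>j=1..n. (x \<bullet> \<phi> j) *\<^sub>R A0 (\<phi> j))"
    unfolding PN_eq_sum using eigen by (intro linear_on_sum[OF A0_linear D_subspace]) auto
  also have "\<dots> = (\<Sum>j=1..n. (ev j * (x \<bullet> \<phi> j)) *\<^sub>R \<phi> j)"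
    using eigen by (intro sum.cong) auto
  finally show ?thesis .
qed

lemma Xc_subset_D: "Xc \<phi> n \<subseteq> D"
  unfolding Xc_def using eigen D_subspace by (intro span_minimal) auto

lemma A0_in_Xc:
  assumes "x \<in> Xc \<phi> n"
  shows "A0 x \<in> Xc \<phi> n"
  using A0_PN[of n x] unfolding PN_ident[OF assms]
  by (simp only:) (intro subspace_sum subspace_scale subspace_Xc basis_in_Xc)

lemmas fin_basis = finite_imageI[OF finite_atLeastAtMost[of "1::nat" N], of \<phi>]

lemma Pc_in_Xc: "x \<in> Xc \<phi> N \<Longrightarrow> Pc x \<in> Xc \<phi> N"
  and Pc_sym: "x \<in> Xc \<phi> N \<Longrightarrow> y \<in> Xc \<phi> N \<Longrightarrow> Pc x \<bullet> y = x \<bullet> Pc y"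
  and Pc_linear: "linear_on (Xc \<phi> N) Pc"
  using Pc_posdef by (auto simp: selfadjoint_posdef_on_def)

lemma R_posdef: "selfadjoint_posdef_on (Xc \<phi> N) R"
  and R_R: "x \<in> Xc \<phi> N \<Longrightarrow> R (R x) = Pc x"
proof -
  let ?Q = "\<lambda>R. selfadjoint_posdef_on (Xc \<phi> N) R \<and> (\<forall>x\<in>Xc \<phi> N. R (R x) = Pc x)"
  have "?Q R"
    unfolding sqrt_on_def
    by (rule someI_ex[of ?Q]) (rule posdef_sqrt_exists[OF fin_basis orthonormal_set_image Pc_posdef[unfolded Xc_def], folded Xc_def])
  then show "selfadjoint_posdef_on (Xc \<phi> N) R" and "x \<in> Xc \<phi> N \<Longrightarrow> R (R x) = Pc x"
    by blast+
qed

lemma R_in_Xc: "x \<in> Xc \<phi> N \<Longrightarrow> R x \<in> Xc \<phi> N"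
  and R_sym: "x \<in> Xc \<phi> N \<Longrightarrow> y \<in> Xc \<phi> N \<Longrightarrow> R x \<bullet> y = x \<bullet> R y"
  and R_linear: "linear_on (Xc \<phi> N) R"
  using R_posdef by (auto simp: selfadjoint_posdef_on_def)

text \<open>An operator that is meaningful on \<open>Xc \<phi> n\<close> only becomes a bounded
  operator of finite rank on the whole space once it is preceded by the projection.\<close>

lemma bounded_linear_comp_PN:
  assumes "linear_on (Xc \<phi> n) T"
  shows "bounded_linear (\<lambda>x. T (PN \<phi> n x))"
proof -
  have "T (PN \<phi> n x) = (\<Sum>j=1..n. (x \<bullet> \<phi> j) *\<^sub>R T (\<phi> j))" for x
    unfolding PN_eq_sum by (rule linear_on_sum[OF assms subspace_Xc]) (rule basis_in_Xc)
  then show ?thesis using bounded_linear_finite_sum[where I = "{1..n}" and u = \<phi>] by simp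
qed

section \<open>Estimates from the coupling norms and the residual growth bound\<close>

lemma bounded_linear_QN: "bounded_linear (\<lambda>x. x - P x)"
  by (intro bounded_linear_sub bounded_linear_ident bounded_linear_PN)

lemma gamma_cs_bound:
  assumes "x \<in> Xs \<phi> N"
  shows "norm (R (Gcs L \<phi> N x)) \<le> gamma_cs L \<phi> N Pc * norm x"
proof -
  have bl: "bounded_linear (\<lambda>x. R (Gcs L \<phi> N x))"
  proof -
    have "bounded_linear (\<lambda>x. - L (x - P x))"
      by (intro bounded_linear_minus bounded_linear_compose[OF blinfun.bounded_linear_right bounded_linear_QN])
    from bounded_linear_compose[OF bounded_linear_comp_PN[OF R_linear] this]
    show ?thesis by (simp add: Gcs_def QN_def PN_minus)
  qed
  then obtain K where "\<And>x. norm (R (Gcs L \<phi> N x)) \<le> norm x * K"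
    using bounded_linear.bounded by blast
  then show ?thesis
    unfolding gamma_cs_def
    by (intro opnorm_on_bound[of _ _ K] assms)
      (auto simp: Xs_def subspace_orthogonal_comp linear_on_def mult.commute
        linear_add[OF bounded_linear.linear[OF bl]] linear_scale[OF bounded_linear.linear[OF bl]])
qed

lemma R_bounded_inverse:
  obtains S where "bounded_linear S" "\<And>x. x \<in> Xc \<phi> N \<Longrightarrow> S x \<in> Xc \<phi> N"
    "\<And>x. x \<in> Xc \<phi> N \<Longrightarrow> S (R x) = x" "\<And>x. x \<in> Xc \<phi> N \<Longrightarrow> R (S x) = x"
  by (rule posdef_bounded_inverse[OF fin_basis orthonormal_set_image R_posdef[unfolded Xc_def], folded Xc_def])
    (rule that)

lemma gamma_sc_bound:
  assumes x: "x \<in> Xc \<phi> N"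
  shows "norm (Gsc L \<phi> N x) \<le> gamma_sc L \<phi> N Pc * norm (R x)"
proof -
  obtain S where S: "bounded_linear S" "\<And>x. x \<in> Xc \<phi> N \<Longrightarrow> S x \<in> Xc \<phi> N"
    "\<And>x. x \<in> Xc \<phi> N \<Longrightarrow> S (R x) = x" "\<And>x. x \<in> Xc \<phi> N \<Longrightarrow> R (S x) = x"
    by (rule R_bounded_inverse) (rule that)
  have inv: "inv_sqrt_on (Xc \<phi> N) Pc y = S y" if "y \<in> Xc \<phi> N" for y
    unfolding inv_sqrt_on_def using S(3)
    by (intro inv_into_f_eq inj_on_inverseI[of _ S] S(2,4) that)
  have bl: "bounded_linear (\<lambda>x. Gsc L \<phi> N (S x))"
  proof -
    have "bounded_linear (\<lambda>x. L (P (S x)))"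
      by (intro bounded_linear_compose[OF blinfun.bounded_linear_right] bounded_linear_compose[OF bounded_linear_PN] S)
    from bounded_linear_minus[OF bounded_linear_compose[OF bounded_linear_QN this]]
    show ?thesis by (simp add: Gsc_def QN_def)
  qed
  then obtain K where K: "\<And>x. norm (Gsc L \<phi> N (S x)) \<le> norm x * K"
    using bounded_linear.bounded by blast
  \<comment> \<open>The operator behind \<open>gamma_sc\<close> is evaluated at \<open>R x\<close>,
    where the inverse square root returns \<open>x\<close>.\<close>
  have "norm (Gsc L \<phi> N (inv_sqrt_on (Xc \<phi> N) Pc (R x))) \<le> gamma_sc L \<phi> N Pc * norm (R x)"
    unfolding gamma_sc_def
  proof (rule opnorm_on_bound[of _ _ K])
    show "linear_on (Xc \<phi> N) (\<lambda>x. Gsc L \<phi> N (inv_sqrt_on (Xc \<phi> N) Pc x))"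
      by (auto simp: linear_on_def inv subspace_add subspace_scale
        linear_add[OF bounded_linear.linear[OF bl]] linear_scale[OF bounded_linear.linear[OF bl]])
  qed (use K x in \<open>auto simp: inv R_in_Xc mult.commute\<close>)
  then show ?thesis using x by (simp add: inv R_in_Xc S(3))
qed

text \<open>On X_s both projections in \<open>ell_s\<close> drop out, and the rest is scaling to the
  unit sphere. The supremum is finite because the quadratic form is bounded by \<open>norm L\<close>
  there.\<close>

lemma ell_s_bound:
  assumes x: "x \<in> Xs \<phi> N"
  shows "- (x \<bullet> L x) \<le> ell_s L \<phi> N * (norm x)\<^sup>2"
proof (cases "x = 0")
  case False
  have eq: "(- QN \<phi> N (L (QN \<phi> N y))) \<bullet> y = - (y \<bullet> L y)" if "y \<in> Xs \<phi> N" for y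
    using PN_eq_0_Xs[OF that] PN_symmetric[of N "L y" y]
    by (simp add: QN_def inner_diff_left inner_commute[of "L y"])
  define u where "u = (1 / norm x) *\<^sub>R x"
  have u: "u \<in> Xs \<phi> N" "norm u = 1"
    using x False by (auto simp: u_def Xs_def intro: subspace_scale[OF subspace_orthogonal_comp])
  have "(- QN \<phi> N (L (QN \<phi> N u))) \<bullet> u \<le> ell_s L \<phi> N"
    unfolding ell_s_def
  proof (rule cSUP_upper)
    show "bdd_above ((\<lambda>x. (- QN \<phi> N (L (QN \<phi> N x))) \<bullet> x) ` {x \<in> Xs \<phi> N. norm x = 1})"
    proof (rule bdd_aboveI2)
      fix y assume y: "y \<in> {x \<in> Xs \<phi> N. norm x = 1}"
      have "- (y \<bullet> L y) \<le> norm y * norm (L y)"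
        using Cauchy_Schwarz_ineq2[of y "L y"] by linarith
      also have "\<dots> \<le> norm L" using norm_blinfun[of L y] y by simp
      finally show "(- QN \<phi> N (L (QN \<phi> N y))) \<bullet> y \<le> norm L" using eq y by simp
    qed
  qed (use u in simp)
  then have "- (u \<bullet> L u) \<le> ell_s L \<phi> N" using eq[OF u(1)] by simp
  then have "- (x \<bullet> L x) / (norm x)\<^sup>2 \<le> ell_s L \<phi> N"
    by (simp add: u_def blinfun.scaleR_right power2_eq_square)
  then show ?thesis using False by (simp add: field_simps)
qed simp

section \<open>The Lyapunov function and its equivalence to the squared norm\<close>

definition lyap_op :: "'a \<Rightarrow> 'a" where "lyap_op x = Pc (P x) + \<eta> *\<^sub>R (x - P x)"

text \<open>Written as the quadratic form of a bounded symmetric operator, so that the gradient is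
  \<open>2 *\<^sub>R lyap_op x\<close> and the chain rule applies at every point of X. The sum of
  squares is recovered in \<open>lyap_eq\<close>.\<close>

definition lyap :: "'a \<Rightarrow> real" where "lyap x = lyap_op x \<bullet> x"

lemma lyap_eq: "lyap x = (norm (R (P x)))\<^sup>2 + \<eta> * (norm (x - P x))\<^sup>2"
proof -
  have "Pc (P x) \<bullet> x = P (Pc (P x)) \<bullet> x" by (simp add: PN_ident Pc_in_Xc PN_in_Xc)
  also have "\<dots> = R (R (P x)) \<bullet> P x" by (simp add: PN_symmetric R_R PN_in_Xc)
  also have "\<dots> = (norm (R (P x)))\<^sup>2"
    by (simp add: R_sym R_in_Xc PN_in_Xc power2_norm_eq_inner)
  finally have 1: "Pc (P x) \<bullet> x = (norm (R (P x)))\<^sup>2" .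
  have "P x \<bullet> (x - P x) = 0" by (simp add: PN_symmetric PN_diff PN_PN_min)
  then have "(x - P x) \<bullet> x = (x - P x) \<bullet> (x - P x)"
    by (simp add: inner_diff_right inner_diff_left inner_commute)
  then have 2: "(x - P x) \<bullet> x = (norm (x - P x))\<^sup>2" by (simp add: power2_norm_eq_inner)
  show ?thesis by (simp add: lyap_def lyap_op_def inner_add_left 1 2)
qed

lemma lyap_nonneg: "0 \<le> lyap x"
  using \<eta>_pos by (simp add: lyap_eq)

lemma bounded_linear_lyap_op: "bounded_linear lyap_op"
  unfolding lyap_op_def[abs_def]
  by (intro bounded_linear_add bounded_linear_comp_PN Pc_linear
      bounded_linear_compose[OF bounded_linear_scaleR_right] bounded_linear_QN)

lemma lyap_op_symmetric: "lyap_op x \<bullet> y = x \<bullet> lyap_op y"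
proof -
  have "Pc (P x) \<bullet> y = P (Pc (P x)) \<bullet> y" by (simp add: PN_ident Pc_in_Xc PN_in_Xc)
  also have "\<dots> = P x \<bullet> Pc (P y)" by (simp add: PN_symmetric Pc_sym PN_in_Xc)
  also have "\<dots> = x \<bullet> P (Pc (P y))" by (rule PN_symmetric)
  also have "\<dots> = x \<bullet> Pc (P y)" by (simp add: PN_ident Pc_in_Xc PN_in_Xc)
  finally show ?thesis
    by (simp add: lyap_op_def inner_add_left inner_add_right inner_diff_left inner_diff_right PN_symmetric)
qed

text \<open>The lower bound needs the bounded inverse of \<open>R\<close>: if it is bounded by
  \<open>K\<close>, the X_c part of the squared norm costs at most the factor
  \<open>1 / K\<^sup>2\<close>, and the X_s part carries the weight \<eta>. The smaller of the two
  is \<open>c\<close>.\<close>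

lemma lyap_equivalent_norm:
  obtains c C where "0 < c" "0 < C" "\<And>x. c * (norm x)\<^sup>2 \<le> lyap x" "\<And>x. lyap x \<le> C * (norm x)\<^sup>2"
proof -
  obtain S where S: "bounded_linear S" "\<And>x. x \<in> Xc \<phi> N \<Longrightarrow> S (R x) = x"
    by (rule R_bounded_inverse) (rule that)
  obtain K where K: "K > 0" "\<And>x. norm (S x) \<le> norm x * K"
    using bounded_linear.pos_bounded[OF S(1)] by blast
  obtain C where C: "C > 0" "\<And>x. norm (lyap_op x) \<le> norm x * C"
    using bounded_linear.pos_bounded[OF bounded_linear_lyap_op] by blast
  define c where "c = min (1 / K\<^sup>2) \<eta>"
  show ?thesis
  proof (rule that)
    show "0 < c" "0 < C" using K(1) \<eta>_pos C(1) by (auto simp: c_def)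
    fix x
    have "(norm (P x))\<^sup>2 \<le> (norm (R (P x)) * K)\<^sup>2"
      using K(2)[of "R (P x)"] S(2)[OF PN_in_Xc[of N x]] by (intro power_mono) auto
    then have "1 / K\<^sup>2 * (norm (P x))\<^sup>2 \<le> (norm (R (P x)))\<^sup>2"
      using K(1) by (simp add: field_simps)
    then have "c * (norm (P x))\<^sup>2 \<le> (norm (R (P x)))\<^sup>2"
      using mult_right_mono[of c "1 / K\<^sup>2" "(norm (P x))\<^sup>2"] by (simp add: c_def)
    moreover have "c * (norm (x - P x))\<^sup>2 \<le> \<eta> * (norm (x - P x))\<^sup>2"
      by (intro mult_right_mono) (auto simp: c_def)
    ultimately show "c * (norm x)\<^sup>2 \<le> lyap x"
      unfolding lyap_eq norm_PN_Pythagoras[of x N] by (simp add: distrib_left)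
    have "lyap x \<le> norm (lyap_op x) * norm x"
      unfolding lyap_def using Cauchy_Schwarz_ineq2[of "lyap_op x" x] by linarith
    also have "\<dots> \<le> norm x * C * norm x" using C(2) by (intro mult_right_mono) auto
    finally show "lyap x \<le> C * (norm x)\<^sup>2" by (simp add: power2_eq_square mult_ac)
  qed
qed

section \<open>Dissipation in the two blocks and their coupling\<close>

lemma Gcc_dissipation:
  assumes d: "d \<in> {dmin..dmax}" and x: "x \<in> Xc \<phi> N"
  shows "- (d * (Pc x \<bullet> A0 x)) - Pc x \<bullet> L x \<le> - \<mu>\<^sub>c * (norm (R x))\<^sup>2"
proof -
  let ?G = "Gcc A0 L \<phi> N d"
  have GX: "?G y \<in> Xc \<phi> N" if "y \<in> Xc \<phi> N" for y
    using A0_in_Xc[OF that] by (auto simp: Gcc_def intro!: subspace_diff subspace_neg subspace_scale PN_in_Xc)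
  have "linear_on (Xc \<phi> N) ?G"
    using A0_linear Xc_subset_D[of N]
    by (auto simp: linear_on_def Gcc_def PN_add PN_scaleR blinfun.add_right blinfun.scaleR_right
        subset_iff algebra_simps)
  from adjoint_on_span[OF fin_basis orthonormal_set_image this[unfolded Xc_def], folded Xc_def, OF x Pc_in_Xc[OF x]]
  have adj: "adjoint_on (Xc \<phi> N) ?G (Pc x) \<bullet> x = Pc x \<bullet> ?G x" by (simp add: inner_commute)
  have "(Pc (?G x) + adjoint_on (Xc \<phi> N) ?G (Pc x)) \<bullet> x \<le> ((- 2 * \<mu>\<^sub>c) *\<^sub>R Pc x) \<bullet> x"
    using lyapunov d x by (auto simp: op_le_on_def)
  \<comment> \<open>Self-adjointness of \<Pi> makes both terms of the Lyapunov inequality equal as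
    quadratic forms, so the factor 2 cancels at the end.\<close>
  then have "2 * (Pc x \<bullet> ?G x) \<le> - 2 * \<mu>\<^sub>c * (Pc x \<bullet> x)"
    using adj Pc_sym[OF GX[OF x] x] by (simp add: inner_add_left inner_add_right inner_commute)
  moreover have "Pc x \<bullet> x = (norm (R x))\<^sup>2"
    using R_sym[OF R_in_Xc[OF x] x] by (simp add: R_R[OF x] power2_norm_eq_inner)
  moreover have "Pc x \<bullet> P (L x) = Pc x \<bullet> L x"
    using PN_symmetric[of N "Pc x" "L x"] by (simp add: PN_ident Pc_in_Xc x)
  ultimately show ?thesis
    by (simp add: Gcc_def PN_ident x inner_diff_right)
qed

text \<open>The left side bounds half of the formal derivative of V along a solution. The
  contribution of \<open>A0\<close> on X_s is already replaced by its worst case, so the estimate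
  makes sense for every \<open>x\<close> and not only on the domain.\<close>

lemma dissipation:
  obtains \<omega> where "0 < \<omega>"
    "\<And>d x. d \<in> {dmin..dmax} \<Longrightarrow>
      - (d * (Pc (P x) \<bullet> A0 (P x))) - \<eta> * dmin * ev (N + 1) * (norm (x - P x))\<^sup>2 - lyap_op x \<bullet> L x
        \<le> - \<omega> * lyap x"
proof -
  define g where "g = gamma_cs L \<phi> N Pc + \<eta> * gamma_sc L \<phi> N Pc"
  define \<delta> where "\<delta> = 4 * \<eta> * \<mu>\<^sub>c * \<mu>\<^sub>s - g\<^sup>2"
  have \<delta>: "\<delta> > 0" using small_gain by (simp add: \<delta>_def g_def)
  \<comment> \<open>The aim is \<open>disc\<close>, the small-gain inequality with both margins
    lowered by \<omega>. Expanding it and dropping the nonnegative term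
    \<open>4 * \<eta> * \<omega>\<^sup>2\<close> leaves the second entry of the minimum; the first
    keeps \<open>\<mu>\<^sub>c - \<omega>\<close> positive.\<close>
  define \<omega> where "\<omega> = min (\<mu>\<^sub>c / 2) (\<delta> / (4 * \<eta> * (\<mu>\<^sub>c + \<mu>\<^sub>s)))"
  have \<omega>: "0 < \<omega>" "\<omega> < \<mu>\<^sub>c"
    using \<mu>\<^sub>c_pos \<mu>\<^sub>s_pos \<eta>_pos \<delta> by (auto simp: \<omega>_def intro!: divide_pos_pos mult_pos_pos add_pos_pos)
  have "\<omega> \<le> \<delta> / (4 * \<eta> * (\<mu>\<^sub>c + \<mu>\<^sub>s))" by (simp add: \<omega>_def)
  then have "\<omega> * (4 * \<eta> * (\<mu>\<^sub>c + \<mu>\<^sub>s)) \<le> \<delta>"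
    using \<mu>\<^sub>c_pos \<mu>\<^sub>s_pos \<eta>_pos by (subst (asm) pos_le_divide_eq) (auto intro!: mult_pos_pos add_pos_pos)
  moreover have "0 \<le> \<eta> * \<omega>\<^sup>2" using \<eta>_pos by simp
  ultimately have disc: "g\<^sup>2 \<le> 4 * (\<mu>\<^sub>c - \<omega>) * (\<eta> * (\<mu>\<^sub>s - \<omega>))"
    unfolding \<delta>_def by (simp add: algebra_simps power2_eq_square)
  show ?thesis
  proof (rule that[OF \<omega>(1)])
    fix d x assume d: "d \<in> {dmin..dmax}"
    define c q where "c = P x" and "q = x - P x"
    define a b where "a = norm (R c)" and "b = norm q"
    have c: "c \<in> Xc \<phi> N" and q: "q \<in> Xs \<phi> N" and x: "x = c + q"
      by (simp_all add: c_def q_def PN_in_Xc diff_PN_in_Xs)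
    have Pq: "P q = 0" and Pcc: "P c = c" using PN_eq_0_Xs[OF q] PN_ident[OF c] by auto
    have 1: "- (d * (Pc c \<bullet> A0 c)) - Pc c \<bullet> L c \<le> - \<mu>\<^sub>c * a\<^sup>2"
      using Gcc_dissipation[OF d c] by (simp add: a_def)
    \<comment> \<open>The weight is split as \<open>R\<close> times \<open>R\<close>, one factor for
      each side, so the coupling is measured by \<open>gamma_cs\<close> and the condition number of
      \<Pi> does not enter.\<close>
    have 2: "- (Pc c \<bullet> L q) \<le> a * (gamma_cs L \<phi> N Pc * b)"
    proof -
      have G: "Gcs L \<phi> N q = P (- L q)" by (simp add: Gcs_def QN_def Pq PN_minus)
      have "- (Pc c \<bullet> L q) = P (Pc c) \<bullet> (- L q)" by (simp add: PN_ident Pc_in_Xc c)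
      also have "\<dots> = R (R c) \<bullet> Gcs L \<phi> N q" by (simp add: PN_symmetric G R_R c PN_minus)
      also have "\<dots> = R c \<bullet> R (Gcs L \<phi> N q)" by (simp add: R_sym R_in_Xc c G PN_in_Xc)
      also have "\<dots> \<le> norm (R c) * norm (R (Gcs L \<phi> N q))" by (rule norm_cauchy_schwarz)
      also have "\<dots> \<le> a * (gamma_cs L \<phi> N Pc * b)"
        unfolding a_def b_def using gamma_cs_bound[OF q] by (intro mult_left_mono) auto
      finally show ?thesis .
    qed
    have 3: "- (q \<bullet> L q) \<le> ell_s L \<phi> N * b\<^sup>2"
      using ell_s_bound[OF q] by (simp add: b_def)
    have 4: "- (q \<bullet> L c) \<le> gamma_sc L \<phi> N Pc * a * b"
    proof -
      have "P (L c) \<bullet> q = 0" by (simp add: PN_symmetric Pq)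
      then have "- (q \<bullet> L c) = Gsc L \<phi> N c \<bullet> q"
        by (simp add: Gsc_def QN_def Pcc inner_diff_left inner_diff_right inner_commute)
      also have "\<dots> \<le> norm (Gsc L \<phi> N c) * norm q" by (rule norm_cauchy_schwarz)
      also have "\<dots> \<le> gamma_sc L \<phi> N Pc * a * b"
        unfolding a_def b_def using gamma_sc_bound[OF c] by (intro mult_right_mono) auto
      finally show ?thesis .
    qed
    have 5: "0 \<le> (\<mu>\<^sub>c - \<omega>) * a\<^sup>2 - g * a * b + \<eta> * (\<mu>\<^sub>s - \<omega>) * b\<^sup>2"
      using \<omega> disc by (intro binary_quadratic_form_nonneg) auto
    have "lyap_op x \<bullet> L x = Pc c \<bullet> L c + Pc c \<bullet> L q + \<eta> * (q \<bullet> L q) + \<eta> * (q \<bullet> L c)"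
      unfolding lyap_op_def c_def[symmetric] q_def[symmetric]
      by (simp add: x blinfun.add_right inner_add_left inner_add_right algebra_simps)
    moreover have "\<eta> * (- (q \<bullet> L q)) \<le> \<eta> * (ell_s L \<phi> N * b\<^sup>2)" "\<eta> * (- (q \<bullet> L c)) \<le> \<eta> * (gamma_sc L \<phi> N Pc * a * b)"
      by (intro mult_left_mono 3 4 less_imp_le[OF \<eta>_pos])+
    ultimately have "- (d * (Pc c \<bullet> A0 c)) - \<eta> * dmin * ev (N + 1) * b\<^sup>2 - lyap_op x \<bullet> L x
        \<le> - \<mu>\<^sub>c * a\<^sup>2 + a * (gamma_cs L \<phi> N Pc * b) + \<eta> * (ell_s L \<phi> N * b\<^sup>2) + \<eta> * (gamma_sc L \<phi> N Pc * a * b)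
          - \<eta> * dmin * ev (N + 1) * b\<^sup>2"
      using 1 2 by linarith
    also have "\<dots> = - \<mu>\<^sub>c * a\<^sup>2 + g * a * b - \<eta> * \<mu>\<^sub>s * b\<^sup>2"
      by (simp add: g_def \<mu>\<^sub>s_def algebra_simps)
    also have "\<dots> \<le> - \<omega> * (a\<^sup>2 + \<eta> * b\<^sup>2)" using 5 by (simp add: algebra_simps)
    also have "a\<^sup>2 + \<eta> * b\<^sup>2 = lyap x" by (simp add: lyap_eq a_def b_def c_def q_def)
    finally show "- (d * (Pc (P x) \<bullet> A0 (P x))) - \<eta> * dmin * ev (N + 1) * (norm (x - P x))\<^sup>2 - lyap_op x \<bullet> L x
        \<le> - \<omega> * lyap x" by (simp add: b_def c_def q_def)
  qed
qed

section \<open>Energy inequality through Galerkin truncations\<close>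

lemma lyap_has_derivative: "(lyap has_derivative (\<lambda>h. (2 *\<^sub>R lyap_op x) \<bullet> h)) (at x)"
proof -
  have "(lyap has_derivative (\<lambda>h. lyap_op x \<bullet> h + lyap_op h \<bullet> x)) (at x)"
    unfolding lyap_def[abs_def]
    by (intro has_derivative_inner bounded_linear_imp_has_derivative bounded_linear_lyap_op has_derivative_ident)
  moreover have "lyap_op h \<bullet> x = lyap_op x \<bullet> h" for h
    using lyap_op_symmetric[of h x] by (simp add: inner_commute)
  ultimately show ?thesis by simp
qed

lemma continuous_on_lyap_op: "continuous_on A f \<Longrightarrow> continuous_on A (\<lambda>r. lyap_op (f r))"
  using bounded_linear.continuous_on[OF bounded_linear_lyap_op] by blast

lemma continuous_on_lyap: "continuous_on A f \<Longrightarrow> continuous_on A (\<lambda>r. lyap (f r))"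
  unfolding lyap_def by (intro continuous_intros continuous_on_lyap_op)

lemma lyap_op_in_Xc:
  assumes "y \<in> Xc \<phi> n" "N \<le> n"
  shows "lyap_op y \<in> Xc \<phi> n"
  unfolding lyap_op_def using assms Xc_mono[OF assms(2)] Pc_in_Xc[OF PN_in_Xc] PN_in_Xc
  by (intro subspace_add subspace_scale subspace_diff subspace_Xc) auto

text \<open>The energy production of the Galerkin truncation to \<open>n\<close> modes differs from that of the
  full system only by terms in the tail \<open>x - PN \<phi> n x\<close>.\<close>

lemma truncated_energy_production:
  assumes d: "d \<in> {dmin..dmax}" and n: "N \<le> n"
  shows "lyap_op (PN \<phi> n x) \<bullet> (\<Sum>j=1..n. (- (d * (ev j * (x \<bullet> \<phi> j))) - L x \<bullet> \<phi> j) *\<^sub>R \<phi> j)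
    \<le> - (d * (Pc (P x) \<bullet> A0 (P x))) - \<eta> * dmin * ev (N + 1) * (norm (x - P x))\<^sup>2 - lyap_op x \<bullet> L x
      + \<eta> * (dmin * ev (N + 1) * (norm (x - PN \<phi> n x))\<^sup>2 + (x - PN \<phi> n x) \<bullet> L x)"
proof -
  define y where "y = PN \<phi> n x"
  have Py: "P y = P x" using n by (simp add: y_def PN_PN_min min_def)
  have opy: "lyap_op y = Pc (P x) + \<eta> *\<^sub>R (y - P x)" by (simp add: lyap_op_def Py)
  have "(\<Sum>j=1..n. (- (d * (ev j * (x \<bullet> \<phi> j))) - L x \<bullet> \<phi> j) *\<^sub>R \<phi> j) = - d *\<^sub>R A0 y - PN \<phi> n (L x)"
    unfolding y_def A0_PN PN_eq_sum[of n "L x"]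
    by (simp add: scaleR_sum_right sum_negf[symmetric] sum_subtractf[symmetric] scaleR_diff_left)
  \<comment> \<open>\<open>lyap_op y\<close> stays in \<open>Xc \<phi> n\<close>, so it does not
    notice the truncation of \<open>L x\<close>.\<close>
  moreover have "lyap_op y \<bullet> PN \<phi> n (L x) = lyap_op y \<bullet> L x"
    using PN_symmetric[of n "lyap_op y" "L x"] PN_ident[OF lyap_op_in_Xc[OF _ n], of y]
    by (simp add: y_def PN_in_Xc)
  ultimately have main: "lyap_op y \<bullet> (\<Sum>j=1..n. (- (d * (ev j * (x \<bullet> \<phi> j))) - L x \<bullet> \<phi> j) *\<^sub>R \<phi> j)
      = - (d * (lyap_op y \<bullet> A0 y)) - lyap_op y \<bullet> L x"
    by (simp add: inner_diff_right)
  have yP: "y - P x = (\<Sum>j=N+1..n. (x \<bullet> \<phi> j) *\<^sub>R \<phi> j)"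
    and A0y: "A0 y = A0 (P x) + (\<Sum>j=N+1..n. (ev j * (x \<bullet> \<phi> j)) *\<^sub>R \<phi> j)"
  proof -
    have "{1..n} = {1..N} \<union> {N+1..n}" using n by auto
    then have *: "(\<Sum>j=1..n. f j) = (\<Sum>j=1..N. f j) + (\<Sum>j=N+1..n. f j)" for f :: "nat \<Rightarrow> 'a"
      by (simp only:) (rule sum.union_disjoint, auto)
    show "y - P x = (\<Sum>j=N+1..n. (x \<bullet> \<phi> j) *\<^sub>R \<phi> j)"
      unfolding y_def PN_eq_sum *[of "\<lambda>j. (x \<bullet> \<phi> j) *\<^sub>R \<phi> j"] by simp
    show "A0 y = A0 (P x) + (\<Sum>j=N+1..n. (ev j * (x \<bullet> \<phi> j)) *\<^sub>R \<phi> j)"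
      unfolding y_def A0_PN by (rule *)
  qed
  \<comment> \<open>The mixed terms vanish because \<Pi> and \<open>A0\<close> both respect the
    splitting into the first \<open>N\<close> modes and the rest.\<close>
  have low: "Pc (P x) \<bullet> (\<Sum>j=N+1..n. (ev j * (x \<bullet> \<phi> j)) *\<^sub>R \<phi> j) = 0"
  proof -
    have "Pc (P x) \<bullet> \<phi> j = 0" if "j \<ge> N + 1" for j
      using PN_inner_basis[of j N "Pc (P x)"] that by (simp add: PN_ident Pc_in_Xc PN_in_Xc)
    then show ?thesis by (auto simp: inner_sum_right intro!: sum.neutral)
  qed
  have cross: "(y - P x) \<bullet> A0 (P x) = 0"
  proof -
    have "P (y - P x) = 0" by (simp add: PN_diff Py PN_PN_min)
    then have "(y - P x) \<bullet> P (A0 (P x)) = 0" using PN_symmetric[of N "y - P x" "A0 (P x)"] by simp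
    then show ?thesis by (simp add: PN_ident A0_in_Xc PN_in_Xc)
  qed
  have tail: "ev (N + 1) * (norm (y - P x))\<^sup>2 \<le> (y - P x) \<bullet> (\<Sum>j=N+1..n. (ev j * (x \<bullet> \<phi> j)) *\<^sub>R \<phi> j)"
  proof -
    have yj: "(y - P x) \<bullet> \<phi> j = x \<bullet> \<phi> j" if "j \<in> {N+1..n}" for j
      using that by (simp add: y_def inner_diff_left PN_inner_basis)
    have "(norm (y - P x))\<^sup>2 = (\<Sum>j=N+1..n. (x \<bullet> \<phi> j)\<^sup>2)"
      unfolding yP by (rule norm_sum_basis) auto
    then have "ev (N + 1) * (norm (y - P x))\<^sup>2 = (\<Sum>j=N+1..n. ev (N + 1) * (x \<bullet> \<phi> j)\<^sup>2)"
      by (simp add: sum_distrib_left)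
    also have "\<dots> \<le> (\<Sum>j=N+1..n. ev j * (x \<bullet> \<phi> j)\<^sup>2)"
      using ev_ge by (intro sum_mono mult_right_mono) auto
    also have "\<dots> = (y - P x) \<bullet> (\<Sum>j=N+1..n. (ev j * (x \<bullet> \<phi> j)) *\<^sub>R \<phi> j)"
      unfolding inner_sum_right by (intro sum.cong refl) (simp add: yj power2_eq_square del: One_nat_def)
    finally show ?thesis .
  qed
  define T where "T = (\<Sum>j=N+1..n. (ev j * (x \<bullet> \<phi> j)) *\<^sub>R \<phi> j)"
  note low = low[folded T_def] and tail = tail[folded T_def] and A0y = A0y[folded T_def]
  have "lyap_op y \<bullet> A0 y \<ge> Pc (P x) \<bullet> A0 (P x) + \<eta> * (ev (N + 1) * (norm (y - P x))\<^sup>2)"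
    using mult_left_mono[OF tail, of \<eta>] \<eta>_pos
    unfolding opy A0y by (simp add: inner_add_left inner_add_right low cross)
  moreover have "0 < d" using d dmin_pos by auto
  ultimately have "d * (lyap_op y \<bullet> A0 y) \<ge> d * (Pc (P x) \<bullet> A0 (P x) + \<eta> * (ev (N + 1) * (norm (y - P x))\<^sup>2))"
    by (intro mult_left_mono) auto
  \<comment> \<open>Only the high-mode term is estimated by \<open>dmin\<close>, since it is
    nonnegative. The low-mode term may have either sign and keeps the actual value of
    \<open>d\<close> for the Lyapunov inequality.\<close>
  moreover have "d * (\<eta> * (ev (N + 1) * (norm (y - P x))\<^sup>2)) \<ge> dmin * (\<eta> * (ev (N + 1) * (norm (y - P x))\<^sup>2))"
    using d \<eta>_pos ev_gt_0[of "N + 1"] by (intro mult_right_mono) auto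
  ultimately have "lyap_op y \<bullet> A0 y * d \<ge> d * (Pc (P x) \<bullet> A0 (P x)) + \<eta> * dmin * ev (N + 1) * (norm (y - P x))\<^sup>2"
    by (simp add: algebra_simps)
  \<comment> \<open>This identity and the next one pass from \<open>y\<close> back to
    \<open>x\<close>; their defects form the error term of the statement.\<close>
  moreover have "(norm (y - P x))\<^sup>2 = (norm (x - P x))\<^sup>2 - (norm (x - y))\<^sup>2"
  proof -
    have "PN \<phi> n (x - P x) = y - P x" using n by (simp add: y_def PN_diff PN_PN_min min_def)
    then show ?thesis using norm_PN_Pythagoras[of "x - P x" n] by simp
  qed
  moreover have "lyap_op y \<bullet> L x = lyap_op x \<bullet> L x - \<eta> * ((x - y) \<bullet> L x)"
    unfolding lyap_op_def Py by (simp add: inner_add_left inner_diff_left algebra_simps)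
  ultimately show ?thesis
    unfolding y_def[symmetric] main by (simp add: algebra_simps)
qed

text \<open>The dissipation estimate is a premise, so that one \<omega>, chosen beforehand, serves
  all trajectories and solutions. Each truncation is a finite sum of absolutely continuous
  coordinates, to which the chain rule applies.\<close>

lemma weak_solution_energy_inequality:
  assumes d: "admissible dmin dmax d" and s0: "0 \<le> s0" and z: "weak_solution \<phi> ev L d s0 z"
    and diss: "\<And>d x. d \<in> {dmin..dmax} \<Longrightarrow>
      - (d * (Pc (P x) \<bullet> A0 (P x))) - \<eta> * dmin * ev (N + 1) * (norm (x - P x))\<^sup>2 - lyap_op x \<bullet> L x
        \<le> - \<omega> * lyap x"
    and st: "s0 \<le> s" "s \<le> t"
  shows "lyap (z t) \<le> lyap (z s) - 2 * \<omega> * (LINT r:{s..t}|lebesgue. lyap (z r))"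
proof -
  have zc: "continuous_on {a..b} z" if "s0 \<le> a" for a b
    using z that unfolding weak_solution_def by (auto intro: continuous_on_subset)
  define q where "q j r = - (d r * (ev j * (z r \<bullet> \<phi> j))) - L (z r) \<bullet> \<phi> j" for j r
  have qi: "set_integrable lebesgue {a..b} (q j)" if "s0 \<le> a" for a b j
    unfolding q_def using that s0 by (intro set_integrable_weak_rhs admissible_set_integrable[OF d] zc) auto
  have zq: "z u \<bullet> \<phi> j = z s \<bullet> \<phi> j + (LINT r:{s..u}|lebesgue. q j r)" if "j \<ge> 1" "s \<le> u" for j u
  proof -
    have "z u \<bullet> \<phi> j = z s0 \<bullet> \<phi> j + (LINT r:{s0..u}|lebesgue. q j r)"
      "z s \<bullet> \<phi> j = z s0 \<bullet> \<phi> j + (LINT r:{s0..s}|lebesgue. q j r)"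
      using z that st(1) unfolding weak_solution_def q_def by (meson order_trans)+
    then show ?thesis
      using set_integral_Icc_split[OF qi st(1) that(2)] by simp
  qed
  define w where "w n r = (\<Sum>j=1..n. q j r *\<^sub>R \<phi> j)" for n r
  define y where "y n r = PN \<phi> n (z r)" for n r
  have qji: "set_integrable lebesgue {a..b} (\<lambda>r. q j r *\<^sub>R \<phi> j)" if "s0 \<le> a" for a b j
    using qi[OF that] by (rule set_integrable_scaleR_left)
  have wi: "set_integrable lebesgue {a..b} (w n)" if "s0 \<le> a" for a b n
    using qji[OF that] unfolding w_def[abs_def] set_integrable_def scaleR_sum_right
    by (intro Bochner_Integration.integrable_sum)
  have yw: "y n u = y n s + (LINT r:{s..u}|lebesgue. w n r)" if "s \<le> u" for n u
  proof -
    have "(LINT r:{s..u}|lebesgue. w n r) = (\<Sum>j=1..n. (LINT r:{s..u}|lebesgue. q j r *\<^sub>R \<phi> j))"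
      using qji[OF st(1)] unfolding w_def set_lebesgue_integral_def scaleR_sum_right set_integrable_def
      by (intro Bochner_Integration.integral_sum)
    also have "\<dots> = (\<Sum>j=1..n. (LINT r:{s..u}|lebesgue. q j r) *\<^sub>R \<phi> j)"
      by (intro sum.cong refl set_integral_scaleR_vector qi st)
    also have "\<dots> = (\<Sum>j=1..n. (z u \<bullet> \<phi> j - z s \<bullet> \<phi> j) *\<^sub>R \<phi> j)"
      using zq[OF _ that] by (intro sum.cong refl) simp
    also have "\<dots> = y n u - y n s"
      by (simp add: y_def PN_eq_sum scaleR_diff_left sum_subtractf)
    finally show ?thesis by simp
  qed
  define e where "e n r = 2 * \<eta> * (dmin * ev (N + 1) * (norm (z r - y n r))\<^sup>2 + (z r - y n r) \<bullet> L (z r))" for n r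
  have yc: "continuous_on {s..t} (y n)" for n
    unfolding y_def[abs_def] using bounded_linear.continuous_on[OF bounded_linear_PN zc[OF st(1)]] .
  have Vi: "set_integrable lebesgue {s..t} (\<lambda>r. lyap (z r))"
    by (intro set_integrable_lebesgue_continuous continuous_on_lyap zc st)
  have ec: "continuous_on {s..t} (e n)" for n
    unfolding e_def[abs_def] by (intro continuous_intros yc zc st)
  have ei: "set_integrable lebesgue {s..t} (e n)" for n
    by (intro set_integrable_lebesgue_continuous ec)
  have trunc: "lyap (y n t) - lyap (y n s)
      \<le> - 2 * \<omega> * (LINT r:{s..t}|lebesgue. lyap (z r)) + (LINT r:{s..t}|lebesgue. e n r)"
    if n: "N \<le> n" for n
  proof -
    have Gc: "continuous_on UNIV (\<lambda>x. 2 *\<^sub>R lyap_op x)"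
      by (intro continuous_intros continuous_on_lyap_op)
    note chain = chain_rule_indefinite_integral[OF st(2) wi[OF st(1)] yw lyap_has_derivative Gc]
    have "lyap (y n t) - lyap (y n s) = (LINT r:{s..t}|lebesgue. (2 *\<^sub>R lyap_op (y n r)) \<bullet> w n r)"
      by (rule chain(2)) auto
    also have "\<dots> \<le> (LINT r:{s..t}|lebesgue. - 2 * \<omega> * lyap (z r) + e n r)"
    proof (rule set_integral_mono)
      show "set_integrable lebesgue {s..t} (\<lambda>r. (2 *\<^sub>R lyap_op (y n r)) \<bullet> w n r)"
        by (rule chain(1)) auto
      show "set_integrable lebesgue {s..t} (\<lambda>r. - 2 * \<omega> * lyap (z r) + e n r)"
        using Vi ei by (intro set_integral_add(1) set_integrable_mult_right)
      fix r assume r: "r \<in> {s..t}"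
      then have "d r \<in> {dmin..dmax}" using d s0 st by (auto simp: admissible_def)
      from truncated_energy_production[OF this n, of "z r"] diss[OF this, of "z r"]
      show "(2 *\<^sub>R lyap_op (y n r)) \<bullet> w n r \<le> - 2 * \<omega> * lyap (z r) + e n r"
        unfolding y_def w_def q_def e_def by (simp del: One_nat_def)
    qed
    also have "\<dots> = - 2 * \<omega> * (LINT r:{s..t}|lebesgue. lyap (z r)) + (LINT r:{s..t}|lebesgue. e n r)"
      by (subst set_integral_add(2)[OF set_integrable_mult_right[OF Vi] ei]) (simp only: set_integral_mult_right)
    finally show ?thesis .
  qed
  \<comment> \<open>The error contains the single eigenvalue \<open>ev (N + 1)\<close> whatever
    \<open>n\<close> is. Boundedness of \<open>z\<close> on the compact interval and contractivity
    of the complementary projections therefore give a dominating constant uniform in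
    \<open>n\<close>, although the eigenvalues are unbounded.\<close>
  have e_lim: "(\<lambda>n. LINT r:{s..t}|lebesgue. e n r) \<longlonglongrightarrow> (LINT r:{s..t}|lebesgue. 0)"
  proof -
    have "bounded (z ` {s..t})"
      using zc[OF st(1)] compact_imp_bounded compact_continuous_image by blast
    then obtain K where K: "\<And>r. r \<in> {s..t} \<Longrightarrow> norm (z r) \<le> K"
      unfolding bounded_iff by blast
    define C where "C = 2 * \<eta> * (dmin * ev (N + 1) * K\<^sup>2 + K * (norm L * K))"
    have eb: "\<bar>e n r\<bar> \<le> C" if r: "r \<in> {s..t}" for n r
    proof -
      have K0: "0 \<le> K" using K[OF r] norm_ge_zero order_trans by blast
      have zy: "norm (z r - y n r) \<le> K" unfolding y_def using norm_diff_PN_le[of "z r" n] K[OF r] by linarith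
      have "\<bar>(z r - y n r) \<bullet> L (z r)\<bar> \<le> norm (z r - y n r) * norm (L (z r))"
        by (rule Cauchy_Schwarz_ineq2)
      also have "\<dots> \<le> K * (norm L * K)"
        using zy K0 norm_blinfun[of L "z r"] mult_left_mono[OF K[OF r], of "norm L"] by (intro mult_mono) auto
      finally have 1: "\<bar>(z r - y n r) \<bullet> L (z r)\<bar> \<le> K * (norm L * K)" .
      have 2: "dmin * ev (N + 1) * (norm (z r - y n r))\<^sup>2 \<le> dmin * ev (N + 1) * K\<^sup>2"
        using zy dmin_pos ev_gt_0[of "N + 1"] by (intro mult_left_mono power_mono) auto
      have "0 \<le> dmin * ev (N + 1) * (norm (z r - y n r))\<^sup>2"
        using dmin_pos ev_gt_0[of "N + 1"] by (intro mult_nonneg_nonneg) auto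
      then have "\<bar>dmin * ev (N + 1) * (norm (z r - y n r))\<^sup>2 + (z r - y n r) \<bullet> L (z r)\<bar>
          \<le> dmin * ev (N + 1) * K\<^sup>2 + K * (norm L * K)"
        using 1 2 by linarith
      then show ?thesis
        unfolding e_def C_def abs_mult using \<eta>_pos by (simp del: One_nat_def add: mult_left_mono)
    qed
    show ?thesis
      unfolding set_lebesgue_integral_def
    proof (rule integral_dominated_convergence[where w = "\<lambda>r. indicator {s..t} r *\<^sub>R C"])
      show "integrable lebesgue (\<lambda>r. indicator {s..t} r *\<^sub>R C)"
        using set_integrable_lebesgue_continuous[of s t "\<lambda>_. C"] by (simp add: set_integrable_def)
      show "(\<lambda>r. indicator {s..t} r *\<^sub>R e n r) \<in> borel_measurable lebesgue" for n
        using ei[of n] unfolding set_integrable_def by (rule borel_measurable_integrable)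
      show "AE r in lebesgue. norm (indicator {s..t} r *\<^sub>R e n r) \<le> indicator {s..t} r *\<^sub>R C" for n
        by (intro AE_I2) (auto simp: indicator_def eb)
      have "(\<lambda>n. e n r) \<longlonglongrightarrow> 0" for r
      proof -
        have "(\<lambda>n. y n r) \<longlonglongrightarrow> z r" unfolding y_def by (rule PN_tendsto)
        then have "(\<lambda>n. e n r) \<longlonglongrightarrow> 2 * \<eta> * (dmin * ev (N + 1) * (norm (z r - z r))\<^sup>2 + (z r - z r) \<bullet> L (z r))"
          unfolding e_def by (intro tendsto_intros)
        then show ?thesis by simp
      qed
      then show "AE r in lebesgue. (\<lambda>n. indicator {s..t} r *\<^sub>R e n r) \<longlonglongrightarrow> indicator {s..t} r *\<^sub>R 0"
        by (intro AE_I2 tendsto_scaleR tendsto_const)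
    qed simp
  qed
  have ylim: "(\<lambda>n. lyap (y n r)) \<longlonglongrightarrow> lyap (z r)" for r
    unfolding y_def
    by (rule isCont_tendsto_compose[OF has_derivative_continuous[OF lyap_has_derivative] PN_tendsto])
  have "lyap (z t) - lyap (z s) \<le> - 2 * \<omega> * (LINT r:{s..t}|lebesgue. lyap (z r)) + 0"
  proof (rule LIMSEQ_le)
    show "(\<lambda>n. lyap (y n t) - lyap (y n s)) \<longlonglongrightarrow> lyap (z t) - lyap (z s)"
      by (intro tendsto_diff ylim)
    show "(\<lambda>n. - 2 * \<omega> * (LINT r:{s..t}|lebesgue. lyap (z r)) + (LINT r:{s..t}|lebesgue. e n r))
        \<longlonglongrightarrow> - 2 * \<omega> * (LINT r:{s..t}|lebesgue. lyap (z r)) + 0"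
      using e_lim by (intro tendsto_add tendsto_const) simp
  qed (use trunc in blast)
  then show ?thesis by simp
qed

text \<open>V decays at rate \<open>2 * \<omega>\<close> and is comparable to the squared norm, so
  taking a square root halves the rate. All constants are obtained before a trajectory is
  fixed.\<close>

lemma weak_solution_exponential_decay:
  obtains M \<omega> where "1 \<le> M" "0 < \<omega>"
    "\<And>d s0 z s t. admissible dmin dmax d \<Longrightarrow> 0 \<le> s0 \<Longrightarrow> weak_solution \<phi> ev L d s0 z \<Longrightarrow> s0 \<le> s \<Longrightarrow> s \<le> t \<Longrightarrow>
      norm (z t) \<le> M * exp (- \<omega> * (t - s)) * norm (z s)"
proof -
  obtain \<omega> where \<omega>: "0 < \<omega>" and diss: "\<And>d x. d \<in> {dmin..dmax} \<Longrightarrow>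
      - (d * (Pc (P x) \<bullet> A0 (P x))) - \<eta> * dmin * ev (N + 1) * (norm (x - P x))\<^sup>2 - lyap_op x \<bullet> L x
        \<le> - \<omega> * lyap x"
    by (rule dissipation) (rule that)
  obtain c C where c: "0 < c" "0 < C" and lo: "\<And>x. c * (norm x)\<^sup>2 \<le> lyap x" and hi: "\<And>x. lyap x \<le> C * (norm x)\<^sup>2"
    by (rule lyap_equivalent_norm) (rule that)
  \<comment> \<open>\<open>sqrt (C / c)\<close> is the price of passing from the norm to V and back;
    the maximum secures \<open>1 \<le> M\<close> without comparing \<open>c\<close> and
    \<open>C\<close>.\<close>
  define M where "M = max 1 (sqrt (C / c))"
  show ?thesis
  proof (rule that[OF _ \<omega>])
    show "1 \<le> M" by (simp add: M_def)
    fix d s0 z s t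
    assume d: "admissible dmin dmax d" and s0: "0 \<le> s0" and z: "weak_solution \<phi> ev L d s0 z"
      and st: "s0 \<le> s" "s \<le> t"
    have zc: "continuous_on {s..t} z"
      using z st unfolding weak_solution_def by (auto intro: continuous_on_subset)
    have "lyap (z t) \<le> exp (- (2 * \<omega>) * (t - s)) * lyap (z s)"
      using st(1) \<omega>
      by (intro exp_decay_of_integral_inequality st(2) continuous_on_lyap zc lyap_nonneg
          weak_solution_energy_inequality[OF d s0 z diss]) auto
    also have "\<dots> \<le> exp (- (2 * \<omega>) * (t - s)) * (C * (norm (z s))\<^sup>2)"
      by (intro mult_left_mono hi) simp
    finally have "c * (norm (z t))\<^sup>2 \<le> exp (- (2 * \<omega>) * (t - s)) * (C * (norm (z s))\<^sup>2)"
      using lo[of "z t"] by (rule order_trans[rotated])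
    then have "(norm (z t))\<^sup>2 \<le> C / c * exp (- (2 * \<omega>) * (t - s)) * (norm (z s))\<^sup>2"
      using c(1) by (simp add: field_simps)
    also have "\<dots> = (sqrt (C / c) * exp (- \<omega> * (t - s)) * norm (z s))\<^sup>2"
      using c by (simp add: power_mult_distrib exp_double[symmetric] mult_ac)
    finally have "norm (z t) \<le> sqrt (C / c) * exp (- \<omega> * (t - s)) * norm (z s)"
      by (rule power2_le_imp_le) (use c in simp)
    also have "\<dots> \<le> M * exp (- \<omega> * (t - s)) * norm (z s)"
      by (intro mult_right_mono) (auto simp: M_def)
    finally show "norm (z t) \<le> M * exp (- \<omega> * (t - s)) * norm (z s)" .
  qed
qed

end

section \<open>Uniform decay for strong solutions, mild solutions and evolution families\<close>

theorem theorem6: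
  fixes D :: "'a::{real_inner, banach, second_countable_topology} set"
    and A0 :: "'a \<Rightarrow> 'a"
    and \<phi> :: "nat \<Rightarrow> 'a" and ev :: "nat \<Rightarrow> real"
    and Ar :: "'a \<Rightarrow>\<^sub>L 'a"
    and B :: "(real ^ 'm) \<Rightarrow>\<^sub>L 'a"
    and C :: "'a \<Rightarrow>\<^sub>L (real ^ 'p)"
    and K1 :: "(real ^ 'p) \<Rightarrow>\<^sub>L (real ^ 'm)"
    and L :: "'a \<Rightarrow>\<^sub>L 'a"
    and N :: nat
    and Pc :: "'a \<Rightarrow> 'a"
    and dmin dmax \<mu>\<^sub>s \<mu>\<^sub>c \<eta> :: real
  assumes "densely_defined_selfadjoint D A0"
    and "strictly_positive D A0"
    and "compact_resolvent D A0"
    and "eigenbasis D A0 \<phi> ev"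
    and "0 < dmin" and "dmin \<le> dmax"
    and "1 \<le> N"
    and "L = Ar - (B o\<^sub>L K1 o\<^sub>L C)"
    and "\<mu>\<^sub>s = dmin * ev (N + 1) - ell_s L \<phi> N" and "0 < \<mu>\<^sub>s"
    and "selfadjoint_posdef_on (Xc \<phi> N) Pc" and "0 < \<mu>\<^sub>c"
    and "\<forall>d\<in>{dmin..dmax}.
           op_le_on (Xc \<phi> N)
             (\<lambda>x. Pc (Gcc A0 L \<phi> N d x) + adjoint_on (Xc \<phi> N) (Gcc A0 L \<phi> N d) (Pc x))
             (\<lambda>x. (- 2 * \<mu>\<^sub>c) *\<^sub>R Pc x)"
    and "0 < \<eta>"
    and "4 * \<eta> * \<mu>\<^sub>c * \<mu>\<^sub>s > (gamma_cs L \<phi> N Pc + \<eta> * gamma_sc L \<phi> N Pc)\<^sup>2"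
  shows "\<exists>M\<ge>1. \<exists>\<omega>>0. \<forall>d. admissible dmin dmax d \<longrightarrow>
           (\<forall>s0\<ge>0. \<forall>z. strong_solution D A0 L d s0 z \<or> mild_solution \<phi> ev L d s0 z \<longrightarrow>
              (\<forall>s t. s0 \<le> s \<and> s \<le> t \<longrightarrow>
                 norm (z t) \<le> M * exp (- \<omega> * (t - s)) * norm (z s))) \<and>
           (\<forall>U. associated_evolution_family \<phi> ev L d U \<longrightarrow>
              (\<forall>s t. 0 \<le> s \<and> s \<le> t \<longrightarrow>
                 norm (U t s) \<le> M * exp (- \<omega> * (t - s))))"
proof -
  have eb: "\<And>j k. 1 \<le> j \<Longrightarrow> 1 \<le> k \<Longrightarrow> \<phi> j \<bullet> \<phi> k = (if j = k then 1 else 0)"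
    "closure (span (\<phi> ` {1..})) = UNIV" "\<And>j. 1 \<le> j \<Longrightarrow> \<phi> j \<in> D \<and> A0 (\<phi> j) = ev j *\<^sub>R \<phi> j"
    "0 < ev 1" "mono_on {1..} ev"
    using assms(4) unfolding eigenbasis_def by blast+
  have sa: "subspace D" "linear_on D A0" "\<And>x y. x \<in> D \<Longrightarrow> y \<in> D \<Longrightarrow> A0 x \<bullet> y = x \<bullet> A0 y"
    using assms(1) unfolding densely_defined_selfadjoint_def by blast+
  interpret stabilized_system \<phi> D A0 ev L N Pc dmin dmax \<mu>\<^sub>s \<mu>\<^sub>c \<eta>
    by unfold_locales (use eb sa assms in blast)+
  obtain M \<omega> where M: "1 \<le> M" and \<omega>: "0 < \<omega>"
    and decay: "\<And>d s0 z s t. admissible dmin dmax d \<Longrightarrow> 0 \<le> s0 \<Longrightarrow> weak_solution \<phi> ev L d s0 z \<Longrightarrow> s0 \<le> s \<Longrightarrow> s \<le> t \<Longrightarrow>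
      norm (z t) \<le> M * exp (- \<omega> * (t - s)) * norm (z s)"
    by (rule weak_solution_exponential_decay) (rule that)
  have mild: "weak_solution \<phi> ev L d s0 z"
    if "admissible dmin dmax d" "0 \<le> s0" "mild_solution \<phi> ev L d s0 z" for d s0 z
    by (rule mild_solution_imp_weak[OF orthonormal_basis_nat_axioms ev_gt_0 that(1)
        less_imp_le[OF dmin_pos] that(2,3)])
  have strong: "weak_solution \<phi> ev L d s0 z"
    if "admissible dmin dmax d" "0 \<le> s0" "strong_solution D A0 L d s0 z" for d s0 z
    by (rule strong_solution_imp_weak[OF that(1,2) sa(3) eb(3) that(3)])
  show ?thesis
  proof (intro exI conjI allI impI)
    show "M \<ge> 1" "\<omega> > 0" by (fact M, fact \<omega>)
  next
    fix d s0 z s t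
    assume "admissible dmin dmax d" "0 \<le> s0" "strong_solution D A0 L d s0 z \<or> mild_solution \<phi> ev L d s0 z"
      "s0 \<le> s \<and> s \<le> t"
    then show "norm (z t) \<le> M * exp (- \<omega> * (t - s)) * norm (z s)"
      using decay mild strong by blast
  next
    fix d U and s t :: real
    assume d: "admissible dmin dmax d" and U: "associated_evolution_family \<phi> ev L d U"
      and st: "0 \<le> s \<and> s \<le> t"
    \<comment> \<open>Each orbit of the family is a mild solution started at time \<open>s\<close>
      itself, and \<open>U s s\<close> is the identity, so decay of vectors becomes a bound on the
      operator norm.\<close>
    have "mild_solution \<phi> ev L d s (\<lambda>t. U t s x)" for x
      using U st by (simp add: associated_evolution_family_def)
    then have "norm (U t s x) \<le> M * exp (- \<omega> * (t - s)) * norm (U s s x)" for x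
      using decay[OF d _ mild[OF d], of s "\<lambda>t. U t s x" s t] st by simp
    moreover have "U s s = id_blinfun"
      using U st by (simp add: associated_evolution_family_def evolution_family_def)
    ultimately show "norm (U t s) \<le> M * exp (- \<omega> * (t - s))"
      using M by (intro norm_blinfun_bound) auto
  qed
qed

end
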